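(* Let $\alpha,\beta>0$, let $a\in L(H_1)$, and let $(a_n)_n$ be a sequence in $\mathcal{M}(\alpha,\beta,(A_0,A_1))$. Then the following conditions are equivalent: (i) $a$ is continuously invertible and $(a_n)_n$ nonlocally $H$-converges to $a$ with respect to $(A_0,A_1)$; (ii) $a\in\mathcal{M}(\alpha,\beta,(A_0,A_1))$, and the sequences $(a_{n,00}^{-1})_n$, $(a_{n,10}a_{n,00}^{-1})_n$, $(a_{n,00}^{-1}a_{n,01})_n$ and $(a_{n,11}-a_{n,10}a_{n,00}^{-1}a_{n,01})_n$ converge in the respective weak operator topologies to $a_{00}^{-1}$, $a_{10}a_{00}^{-1}$, $a_{00}^{-1}a_{01}$ and $a_{11}-a_{10}a_{00}^{-1}a_{01}$, respectively.
   Context: Hilbert spaces are complex; $L(K_0,K_1)$ denotes bounded linear operators, $L(K)=L(K,K)$. $K^*$ is the space of bounded functionals on $K$, with the convention (linear or conjugate-linear) that $v\mapsto\langle w,v\rangle$ belongs to $K^*$. For $T\in L(K)$, $\operatorname{Re}T=\frac12(T+T^* )$, and $\operatorname{Re}T\ge c$ means $\operatorname{Re}\langle T\phi,\phi\rangle\ge c\|\phi\|^2$ for all $\phi$. Standing setting: $H_0,H_1,H_2$ are Hilbert spaces; $A_0:\operatorname{dom}(A_0)\subseteq H_0\to H_1$ and $A_1:\operatorname{dom}(A_1)\subseteq H_1\to H_2$ are densely defined closed linear operators; $(A_0,A_1)$ is closed and exact, i.e. $\operatorname{ran}(A_0)$, $\operatorname{ran}(A_1)$ are closed and $\operatorname{ran}(A_0)=\ker(A_1)$.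 Then $H_1=\operatorname{ran}(A_0)\oplus\operatorname{ran}(A_1^* )$ orthogonally. Let $\iota_0:\operatorname{ran}(A_0)\hookrightarrow H_1$ and $\iota_1:\operatorname{ran}(A_1^* )\hookrightarrow H_1$ be the canonical embeddings. For $a\in L(H_1)$ put $a_{jk}=\iota_j^*a\iota_k$ ($j,k\in\{0,1\}$), and $a_{n,jk}=(a_n)_{jk}$; $a_{00}^{-1}$ means $(a_{00})^{-1}$ and $(a^{-1})_{11}^{-1}$ means $((a^{-1})_{11})^{-1}$. For $\alpha,\beta>0$, $\mathcal{M}(\alpha,\beta,(A_0,A_1))$ is the set of continuously invertible $a\in L(H_1)$ with $\operatorname{Re}a_{00}\ge\alpha$, $\operatorname{Re}a_{00}^{-1}\ge1/\beta$, $\operatorname{Re}(a^{-1})_{11}\ge1/\beta$, $\operatorname{Re}(a^{-1})_{11}^{-1}\ge\alpha$. Let $\mathcal{A}_0$ be $A_0$ restricted to $\operatorname{dom}(\mathcal{A}_0)=\operatorname{dom}(A_0)\cap\operatorname{ran}(A_0^* )$ (note $\operatorname{ran}(A_0^* )=\ker(A_0)^\perp$), with values in $\operatorname{ran}(A_0)$, and $\mathcal{A}_1^*$ be $A_1^*$ restricted to $\operatorname{dom}(\mathcal{A}_1^* )=\operatorname{dom}(A_1^* )\cap\operatorname{ran}(A_1)$, with values in $\operatorname{ran}(A_1^* )$; domains carry graph norms. Nonlocal $H$-convergence: a sequence $(a_n)_n$ in $\mathcal{M}(\alpha,\beta,(A_0,A_1))$ is nonlocally $H$-convergent to a continuously invertible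 $a\in L(H_1)$ with respect to $(A_0,A_1)$ if for all $f\in\operatorname{dom}(\mathcal{A}_0)^*$ and $g\in\operatorname{dom}(\mathcal{A}_1^* )^*$, the (unique) $u_n\in\operatorname{dom}(\mathcal{A}_0)$, $v_n\in\operatorname{dom}(\mathcal{A}_1^* )$ with $\langle a_nA_0u_n,A_0\phi\rangle=f(\phi)$ and $\langle a_n^{-1}A_1^*v_n,A_1^*\psi\rangle=g(\psi)$ for all $\phi\in\operatorname{dom}(\mathcal{A}_0)$, $\psi\in\operatorname{dom}(\mathcal{A}_1^* )$ satisfy: $u_n\rightharpoonup u$ weakly in $\operatorname{dom}(A_0)$ for some $u$; $v_n\rightharpoonup v$ weakly in $\operatorname{dom}(A_1^* )$ for some $v$; $a_nA_0u_n\rightharpoonup aA_0u$ and $a_n^{-1}A_1^*v_n\rightharpoonup a^{-1}A_1^*v$ weakly in $H_1$; and $\langle aA_0u,A_0\phi\rangle=f(\phi)$, $\langle a^{-1}A_1^*v,A_1^*\psi\rangle=g(\psi)$ for all $\phi\in\operatorname{dom}(\mathcal{A}_0)$, $\psi\in\operatorname{dom}(\mathcal{A}_1^* )$. *)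

theory Defs
  imports "HOL-Analysis.Analysis"
begin

section \<open>Complex Hilbert spaces\<close>

text \<open>
  The complex inner product is conjugate-linear in its first and linear in its second argument;
  the underlying real inner product (hence norm and topology) is its real part.
\<close>

class complex_inner = real_inner +
  fixes scaleC :: "complex \<Rightarrow> 'a \<Rightarrow> 'a" (infixr "*\<^sub>C" 75)
    and cinner :: "'a \<Rightarrow> 'a \<Rightarrow> complex"
  assumes scaleC_add_right: "c *\<^sub>C (x + y) = c *\<^sub>C x + c *\<^sub>C y"
    and scaleC_add_left: "(c + d) *\<^sub>C x = c *\<^sub>C x + d *\<^sub>C x"
    and scaleC_scaleC: "c *\<^sub>C (d *\<^sub>C x) = (c * d) *\<^sub>C x"
    and scaleR_scaleC: "r *\<^sub>R x = complex_of_real r *\<^sub>C x"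
    and cinner_commute: "cinner x y = cnj (cinner y x)"
    and cinner_add_right: "cinner x (y + z) = cinner x y + cinner x z"
    and cinner_scaleC_right: "cinner x (c *\<^sub>C y) = c * cinner x y"
    and inner_eq_Re_cinner: "inner x y = Re (cinner x y)"

class chilbert_space = complex_inner + complete_space

instantiation complex :: complex_inner
begin

definition scaleC_complex :: "complex \<Rightarrow> complex \<Rightarrow> complex"
  where "scaleC_complex c z = c * z"

definition cinner_complex :: "complex \<Rightarrow> complex \<Rightarrow> complex"
  where "cinner_complex w z = cnj w * z"

instance
  by standard
    (auto simp: scaleC_complex_def cinner_complex_def algebra_simps scaleR_conv_of_real
      inner_complex_def)

end

instance complex :: chilbert_space ..

section \<open>Linear maps, dual spaces and weak convergence\<close>

definition csubspace :: "'a::complex_inner set \<Rightarrow> bool"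
  where "csubspace S \<longleftrightarrow> 0 \<in> S \<and> (\<forall>x\<in>S. \<forall>y\<in>S. x + y \<in> S) \<and> (\<forall>c. \<forall>x\<in>S. c *\<^sub>C x \<in> S)"

definition clinear_on :: "'a::complex_inner set \<Rightarrow> ('a \<Rightarrow> 'b::complex_inner) \<Rightarrow> bool"
  where "clinear_on S f \<longleftrightarrow>
    (\<forall>x\<in>S. \<forall>y\<in>S. f (x + y) = f x + f y) \<and> (\<forall>c. \<forall>x\<in>S. f (c *\<^sub>C x) = c *\<^sub>C f x)"

definition bounded_clinear :: "('a::complex_inner \<Rightarrow> 'b::complex_inner) \<Rightarrow> bool"
  where "bounded_clinear f \<longleftrightarrow> bounded_linear f \<and> (\<forall>c x. f (c *\<^sub>C x) = c *\<^sub>C f x)"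

definition cont_invertible :: "('a::complex_inner \<Rightarrow> 'a) \<Rightarrow> bool"
  where "cont_invertible a \<longleftrightarrow> bounded_clinear a \<and> bij a \<and> bounded_clinear (inv a)"

text \<open>
  The dual of the space \<open>S\<close> normed by \<open>N\<close>.  Only the values of a functional on \<open>S\<close> are relevant.
\<close>

definition dual_on :: "'a::complex_inner set \<Rightarrow> ('a \<Rightarrow> real) \<Rightarrow> ('a \<Rightarrow> complex) set"
  where "dual_on S N = {f. clinear_on S f \<and> (\<exists>C. \<forall>x\<in>S. cmod (f x) \<le> C * N x)}"

definition weakly_converges_on ::
  "'a::complex_inner set \<Rightarrow> ('a \<Rightarrow> real) \<Rightarrow> (nat \<Rightarrow> 'a) \<Rightarrow> 'a \<Rightarrow> bool"
  where "weakly_converges_on S N x l \<longleftrightarrow>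
    (\<forall>n. x n \<in> S) \<and> l \<in> S \<and> (\<forall>f\<in>dual_on S N. (\<lambda>n. f (x n)) \<longlonglongrightarrow> f l)"

text \<open>
  Weak operator topology on the operators from the subspace \<open>S\<close> to the subspace \<open>R\<close>.
\<close>

definition wot_converges ::
  "'a::complex_inner set \<Rightarrow> 'b::complex_inner set \<Rightarrow> (nat \<Rightarrow> 'a \<Rightarrow> 'b) \<Rightarrow> ('a \<Rightarrow> 'b) \<Rightarrow> bool"
  where "wot_converges S R T L \<longleftrightarrow> (\<forall>x\<in>S. weakly_converges_on R norm (\<lambda>n. T n x) (L x))"

definition Re_ge_on :: "'a::complex_inner set \<Rightarrow> ('a \<Rightarrow> 'a) \<Rightarrow> real \<Rightarrow> bool"
  where "Re_ge_on S T c \<longleftrightarrow> (\<forall>x\<in>S. Re (cinner (T x) x) \<ge> c * (norm x)\<^sup>2)"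

section \<open>Unbounded operators\<close>

text \<open>
  A partially defined operator; the values of \<open>op_app\<close> outside \<open>op_dom\<close> carry no meaning.
\<close>

datatype ('a, 'b) pop = Pop (op_dom: "'a set") (op_app: "'a \<Rightarrow> 'b")

definition op_ran :: "('a, 'b) pop \<Rightarrow> 'b set"
  where "op_ran A = op_app A ` op_dom A"

definition op_ker :: "('a, 'b::zero) pop \<Rightarrow> 'a set"
  where "op_ker A = {x \<in> op_dom A. op_app A x = 0}"

definition op_restrict :: "('a, 'b) pop \<Rightarrow> 'a set \<Rightarrow> ('a, 'b) pop"
  where "op_restrict A S = Pop (op_dom A \<inter> S) (op_app A)"

definition densely_defined_closed :: "('a::complex_inner, 'b::complex_inner) pop \<Rightarrow> bool"
  where "densely_defined_closed A \<longleftrightarrow>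
    csubspace (op_dom A) \<and> clinear_on (op_dom A) (op_app A) \<and>
    closure (op_dom A) = UNIV \<and> closed {(x, op_app A x) |x. x \<in> op_dom A}"

definition op_adj :: "('a::complex_inner, 'b::complex_inner) pop \<Rightarrow> ('b, 'a) pop"
  where "op_adj A =
    Pop {y. \<exists>z. \<forall>x\<in>op_dom A. cinner y (op_app A x) = cinner z x}
      (\<lambda>y. THE z. \<forall>x\<in>op_dom A. cinner y (op_app A x) = cinner z x)"

definition graph_norm :: "('a::complex_inner, 'b::complex_inner) pop \<Rightarrow> 'a \<Rightarrow> real"
  where "graph_norm A x = sqrt ((norm x)\<^sup>2 + (norm (op_app A x))\<^sup>2)"

definition closed_exact ::
  "('a::complex_inner, 'b::complex_inner) pop \<Rightarrow> ('b, 'c::complex_inner) pop \<Rightarrow> bool"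
  where "closed_exact A0 A1 \<longleftrightarrow>
    closed (op_ran A0) \<and> closed (op_ran A1) \<and> op_ran A0 = op_ker A1"

section \<open>Block operators and the class \<open>\<M>(\<alpha>, \<beta>, (A\<^sub>0, A\<^sub>1))\<close>\<close>

text \<open>
  The adjoint of the canonical embedding of a closed subspace \<open>R\<close>.
\<close>

definition emb_adj :: "'a::complex_inner set \<Rightarrow> 'a \<Rightarrow> 'a"
  where "emb_adj R x = (THE y. y \<in> R \<and> (\<forall>z\<in>R. cinner y z = cinner x z))"

text \<open>
  The two components of \<open>H\<^sub>1\<close>; only the indices \<open>0\<close> and \<open>1\<close> are used.
\<close>

definition comp_space ::
  "('a::complex_inner, 'b::complex_inner) pop \<Rightarrow> ('b, 'c::complex_inner) pop \<Rightarrow> nat \<Rightarrow> 'b set"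
  where "comp_space A0 A1 j = (if j = 0 then op_ran A0 else op_ran (op_adj A1))"

definition block ::
  "('a::complex_inner, 'b::complex_inner) pop \<Rightarrow> ('b, 'c::complex_inner) pop \<Rightarrow>
    nat \<Rightarrow> nat \<Rightarrow> ('b \<Rightarrow> 'b) \<Rightarrow> 'b \<Rightarrow> 'b"
  where "block A0 A1 j k a = (\<lambda>x\<in>comp_space A0 A1 k. emb_adj (comp_space A0 A1 j) (a x))"

text \<open>
  The inverse of a diagonal block.  It is only ever formed for blocks with real part bounded below
  by a positive constant, which are bijections of \<open>comp_space A0 A1 j\<close>.
\<close>

definition block_inv ::
  "('a::complex_inner, 'b::complex_inner) pop \<Rightarrow> ('b, 'c::complex_inner) pop \<Rightarrow>
    nat \<Rightarrow> ('b \<Rightarrow> 'b) \<Rightarrow> 'b \<Rightarrow> 'b"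
  where "block_inv A0 A1 j a = inv_into (comp_space A0 A1 j) (block A0 A1 j j a)"

definition op_class ::
  "real \<Rightarrow> real \<Rightarrow> ('a::complex_inner, 'b::complex_inner) pop \<Rightarrow>
    ('b, 'c::complex_inner) pop \<Rightarrow> ('b \<Rightarrow> 'b) set"
  where "op_class \<alpha> \<beta> A0 A1 = {a. cont_invertible a \<and>
    Re_ge_on (comp_space A0 A1 0) (block A0 A1 0 0 a) \<alpha> \<and>
    Re_ge_on (comp_space A0 A1 0) (block_inv A0 A1 0 a) (1 / \<beta>) \<and>
    Re_ge_on (comp_space A0 A1 1) (block A0 A1 1 1 (inv a)) (1 / \<beta>) \<and>
    Re_ge_on (comp_space A0 A1 1) (block_inv A0 A1 1 (inv a)) \<alpha>}"

section \<open>Nonlocal H-convergence\<close>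

text \<open>
  The reduced operator \<open>\<A>\<^sub>0\<close> and the reduced adjoint \<open>\<A>\<^sub>1\<^sup>*\<close>.
\<close>

definition red :: "('a::complex_inner, 'b::complex_inner) pop \<Rightarrow> ('a, 'b) pop"
  where "red A0 = op_restrict A0 (op_ran (op_adj A0))"

definition red_adj :: "('a::complex_inner, 'b::complex_inner) pop \<Rightarrow> ('b, 'a) pop"
  where "red_adj A1 = op_restrict (op_adj A1) (op_ran A1)"

text \<open>
  \<open>u\<close> solves \<open>\<langle>b B u, B \<phi>\<rangle> = f \<phi>\<close> for all \<open>\<phi>\<close> in the domain of \<open>B\<close>.
\<close>

definition satisfies_eq ::
  "('b \<Rightarrow> 'b) \<Rightarrow> ('a::complex_inner, 'b::complex_inner) pop \<Rightarrow> ('a \<Rightarrow> complex) \<Rightarrow> 'a \<Rightarrow> bool"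
  where "satisfies_eq b B f u \<longleftrightarrow>
    (\<forall>\<phi>\<in>op_dom B. cinner (b (op_app B u)) (op_app B \<phi>) = f \<phi>)"

text \<open>
  For \<open>a n\<close> in \<open>op_class \<alpha> \<beta> A0 A1\<close> with \<open>\<alpha>, \<beta> > 0\<close> the solutions \<open>u n\<close> and \<open>v n\<close> below exist and
  are unique, by the Lax--Milgram lemma.
\<close>

definition nonlocally_H_converges ::
  "('a::complex_inner, 'b::complex_inner) pop \<Rightarrow> ('b, 'c::complex_inner) pop \<Rightarrow>
    (nat \<Rightarrow> 'b \<Rightarrow> 'b) \<Rightarrow> ('b \<Rightarrow> 'b) \<Rightarrow> bool"
  where "nonlocally_H_converges A0 A1 an a \<longleftrightarrow>
    (\<forall>f \<in> dual_on (op_dom (red A0)) (graph_norm (red A0)).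
     \<forall>g \<in> dual_on (op_dom (red_adj A1)) (graph_norm (red_adj A1)).
     \<forall>un vn.
       (\<forall>n. un n \<in> op_dom (red A0) \<and> satisfies_eq (an n) (red A0) f (un n)) \<and>
       (\<forall>n. vn n \<in> op_dom (red_adj A1) \<and> satisfies_eq (inv (an n)) (red_adj A1) g (vn n)) \<longrightarrow>
       (\<exists>u v.
          weakly_converges_on (op_dom A0) (graph_norm A0) un u \<and>
          weakly_converges_on (op_dom (op_adj A1)) (graph_norm (op_adj A1)) vn v \<and>
          weakly_converges_on UNIV norm (\<lambda>n. an n (op_app A0 (un n))) (a (op_app A0 u)) \<and>
          weakly_converges_on UNIV norm
            (\<lambda>n. inv (an n) (op_app (op_adj A1) (vn n))) (inv a (op_app (op_adj A1) v)) \<and>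
          satisfies_eq a (red A0) f u \<and>
          satisfies_eq (inv a) (red_adj A1) g v))"

end

theory Submission
  imports Defs
begin

text \<open>
  Let \<open>V\<^sub>0 = ran A\<^sub>0\<close> and \<open>V\<^sub>1 = ran A\<^sub>1\<^sup>*\<close>.  By the closed range theorem (\<open>op_ran_adj\<close>) and exactness, \<open>V\<^sub>1\<close> is
  the orthogonal complement of \<open>V\<^sub>0\<close>, and the reduced operators are isomorphisms of their domains
  with graph norm onto \<open>V\<^sub>0\<close> and \<open>V\<^sub>1\<close> (\<open>reduced_iso_operator\<close>, \<open>reduced_iso_adjoint\<close>).  By Riesz the
  data \<open>f\<close> and \<open>g\<close> are therefore vectors \<open>F \<in> V\<^sub>0\<close> and \<open>G \<in> V\<^sub>1\<close>, and the solutions are given by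
  \<open>A\<^sub>0 u\<^sub>n = a\<^sub>n\<^sub>,\<^sub>0\<^sub>0\<^sup>-\<^sup>1 F\<close> and \<open>A\<^sub>1\<^sup>* v\<^sub>n = (a\<^sub>n\<^sup>-\<^sup>1)\<^sub>1\<^sub>1\<^sup>-\<^sup>1 G\<close>.  The operators \<open>A\<^sub>0\<close> and \<open>A\<^sub>1\<close> thus disappear, and
  nonlocal H-convergence becomes a statement about weak limits of inverse compressions
  (\<open>nonlocally_H_converges_iff_compr\<close>).

  It remains to compare block matrices.  On the one hand
  \<open>a\<^sub>n a\<^sub>n\<^sub>,\<^sub>0\<^sub>0\<^sup>-\<^sup>1 F = F + a\<^sub>n\<^sub>,\<^sub>1\<^sub>0 a\<^sub>n\<^sub>,\<^sub>0\<^sub>0\<^sup>-\<^sup>1 F\<close>, which yields the first two weak operator limits.  On the other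
  hand \<open>(a\<^sub>n\<^sup>-\<^sup>1)\<^sub>1\<^sub>1\<^sup>-\<^sup>1\<close> is the Schur complement of \<open>a\<^sub>n\<^sub>,\<^sub>0\<^sub>0\<close>, and \<open>a\<^sub>n\<^sup>-\<^sup>1\<close> maps its value at \<open>G\<close> to
  \<open>G - a\<^sub>n\<^sub>,\<^sub>0\<^sub>0\<^sup>-\<^sup>1 a\<^sub>n\<^sub>,\<^sub>0\<^sub>1 G\<close> (\<open>compr_inv_inv\<close>, \<open>inv_schur\<close>), which yields the other two.

  In the direction from H-convergence one also has to identify the limits and to show that \<open>a\<close>
  satisfies the bounds of the class.  Both follow from \<open>coercive_pair_limit\<close>: a weak limit of
  inverses of uniformly coercive operators that is a right inverse of \<open>a\<^sub>0\<^sub>0\<close> is coercive itself, hence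
  onto by the Lax--Milgram lemma, and hence the inverse of \<open>a\<^sub>0\<^sub>0\<close>.
\<close>

section \<open>Complex inner products\<close>

lemma cinner_add_left: "cinner (x + y) z = cinner x z + cinner y z"
  by (metis cinner_add_right cinner_commute complex_cnj_add)

lemma cinner_scaleC_left: "cinner (c *\<^sub>C x) y = cnj c * cinner x y"
  by (metis cinner_commute cinner_scaleC_right complex_cnj_mult)

lemma scaleC_minus_one: "(-1) *\<^sub>C x = - (x::'a::complex_inner)"
  using scaleR_scaleC[of "-1" x] by simp

lemma scaleC_zero_left: "0 *\<^sub>C x = (0::'a::complex_inner)"
  using scaleR_scaleC[of 0 x] by simp

lemma cinner_zero_right [simp]: "cinner x 0 = 0"
  using cinner_add_right[of x 0 0] by simp

lemma cinner_zero_left [simp]: "cinner 0 x = 0"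
  using cinner_add_left[of 0 0 x] by simp

lemma cinner_minus_right: "cinner x (- y) = - cinner x y"
  by (metis cinner_add_right add_eq_0_iff cinner_zero_right add.right_inverse)

lemma cinner_diff_right: "cinner x (y - z) = cinner x y - cinner x z"
  using cinner_add_right[of x y "- z"] by (simp add: cinner_minus_right)

text \<open>
  A complex inner product is determined by its real part, because its imaginary part is the
  real part of the inner product with a rotated vector.
\<close>

lemma Im_cinner: "Im (cinner x y) = inner (\<i> *\<^sub>C x) y"
  by (simp add: inner_eq_Re_cinner cinner_scaleC_left)

lemma cinner_eq_Complex: "cinner x y = Complex (inner x y) (inner (\<i> *\<^sub>C x) y)"
  by (simp add: complex_eq_iff Im_cinner inner_eq_Re_cinner)

lemma norm_scaleC: "norm (c *\<^sub>C x) = cmod c * norm (x::'a::complex_inner)"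
proof -
  have "(norm (c *\<^sub>C x))\<^sup>2 = Re (cnj c * c * cinner x x)"
    by (simp add: power2_norm_eq_inner inner_eq_Re_cinner cinner_scaleC_left cinner_scaleC_right
        ac_simps)
  also have cc: "cnj c * c = complex_of_real ((cmod c)\<^sup>2)"
    by (metis complex_norm_square mult.commute)
  also have "Re (complex_of_real ((cmod c)\<^sup>2) * cinner x x) = (cmod c)\<^sup>2 * (norm x)\<^sup>2"
    by (simp only: Re_complex_of_real times_complex.sel Im_complex_of_real power2_norm_eq_inner
        inner_eq_Re_cinner)
  finally show ?thesis
    by (simp flip: power_mult_distrib)
qed

lemma norm_cinner_le: "cmod (cinner x y) \<le> norm x * norm (y::'a::complex_inner)"
proof -
  let ?z = "cinner x y"
  have "cmod ?z * cmod ?z = Re (cnj ?z * ?z)"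
    by (metis Re_complex_of_real complex_norm_square mult.commute power2_eq_square of_real_mult)
  also have "\<dots> = inner x (cnj ?z *\<^sub>C y)"
    by (simp add: inner_eq_Re_cinner cinner_scaleC_right)
  also have "\<dots> \<le> norm x * norm (cnj ?z *\<^sub>C y)"
    by (rule norm_cauchy_schwarz)
  also have "\<dots> = cmod ?z * (norm x * norm y)"
    by (simp add: norm_scaleC)
  finally have "cmod ?z * cmod ?z \<le> cmod ?z * (norm x * norm y)" .
  then show ?thesis
    by (cases "?z = 0") (auto dest: mult_left_le_imp_le)
qed

lemma csubspace_scaleC: "csubspace V \<Longrightarrow> x \<in> V \<Longrightarrow> c *\<^sub>C x \<in> V"
  by (auto simp: csubspace_def)

lemma csubspace_imp_subspace: "csubspace V \<Longrightarrow> subspace V"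
  unfolding csubspace_def subspace_def by (simp add: scaleR_scaleC)

text \<open>
  A complex subspace is invariant under multiplication by \<open>\<i>\<close>, so real orthogonality to it also
  controls the imaginary parts.
\<close>

lemma cinner_eq_on_iff_inner_eq_on:
  assumes "csubspace V"
  shows "(\<forall>z\<in>V. cinner x z = cinner y z) \<longleftrightarrow> (\<forall>z\<in>V. inner x z = inner y z)"
proof
  assume *: "\<forall>z\<in>V. inner x z = inner y z"
  show "\<forall>z\<in>V. cinner x z = cinner y z"
  proof
    fix z assume "z \<in> V"
    moreover have "Im (cinner w z) = - inner w (\<i> *\<^sub>C z)" for w
      by (simp add: inner_eq_Re_cinner cinner_scaleC_right)
    ultimately show "cinner x z = cinner y z"
      using * csubspace_scaleC[OF assms, of z \<i>] by (simp add: complex_eq_iff inner_eq_Re_cinner)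
  qed
qed (simp add: inner_eq_Re_cinner)

lemma clinear_on_zero:
  assumes "csubspace D" "clinear_on D f"
  shows "f 0 = 0"
proof -
  have "f (0 *\<^sub>C 0) = 0 *\<^sub>C f 0"
    using assms by (auto simp: clinear_on_def csubspace_def)
  then show ?thesis
    by (simp add: scaleC_zero_left)
qed

lemma clinear_on_diff:
  assumes "csubspace D" "clinear_on D f" "x \<in> D" "y \<in> D"
  shows "f (x - y) = f x - f y"
proof -
  have "f (x + (-1) *\<^sub>C y) = f x + (-1) *\<^sub>C f y"
    using assms csubspace_scaleC[OF assms(1,4)] by (simp add: clinear_on_def)
  then show ?thesis
    by (simp add: scaleC_minus_one)
qed

section \<open>The Riesz representation and orthogonal projections\<close>

text \<open>
  The representing vector minimises \<open>J x = |x|\<^sup>2 - 2 f x\<close>.  The parallelogram law shows that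
  minimising sequences are Cauchy, and the first variation of \<open>J\<close> vanishes at the minimiser.
\<close>

lemma riesz_representation_real:
  fixes V :: "'a::{real_inner, complete_space} set" and f :: "'a \<Rightarrow> real"
  assumes V: "subspace V" "closed V"
    and add: "\<And>x y. x \<in> V \<Longrightarrow> y \<in> V \<Longrightarrow> f (x + y) = f x + f y"
    and scale: "\<And>r x. x \<in> V \<Longrightarrow> f (r *\<^sub>R x) = r * f x"
    and bound: "\<And>x. x \<in> V \<Longrightarrow> \<bar>f x\<bar> \<le> K * norm x"
  shows "\<exists>y\<in>V. \<forall>z\<in>V. inner y z = f z"
proof -
  define J where "J x = inner x x - 2 * f x" for x
  have diff: "f (x - y) = f x - f y" if "x \<in> V" "y \<in> V" for x y
    using add[of x "(-1) *\<^sub>R y"] scale[of y "-1"] that V(1) by (simp add: subspace_scale subspace_neg)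
  have lower: "- K\<^sup>2 \<le> J x" if "x \<in> V" for x
  proof -
    have "0 \<le> (norm x - K)\<^sup>2" by simp
    then show ?thesis
      using bound[OF that] unfolding J_def
      by (simp add: power2_diff power2_norm_eq_inner mult.commute abs_le_iff)
  qed
  have bdd: "bdd_below (J ` V)"
    using lower by (auto simp: bdd_below_def)
  define m where "m = Inf (J ` V)"
  have m_le: "m \<le> J x" if "x \<in> V" for x
    unfolding m_def using bdd that by (simp add: cINF_lower)
  have "\<exists>x\<in>V. J x < m + 1 / Suc n" for n
  proof -
    have "J ` V \<noteq> {}"
      using subspace_0[OF V(1)] by auto
    moreover have "Inf (J ` V) < m + 1 / Suc n"
      by (simp add: m_def)
    ultimately have "\<exists>r\<in>J ` V. r < m + 1 / Suc n"
      by (rule cInf_lessD)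
    then show ?thesis by simp
  qed
  then obtain x where x: "\<And>n. x n \<in> V" "\<And>n. J (x n) < m + 1 / Suc n"
    by metis
  have par: "inner (u - v) (u - v) \<le> 2 * (J u - m) + 2 * (J v - m)" if "u \<in> V" "v \<in> V" for u v
  proof -
    let ?w = "(1/2) *\<^sub>R (u + v)"
    have w: "?w \<in> V"
      using V(1) that by (simp add: subspace_add subspace_scale)
    have "f ?w = (f u + f v) / 2"
      using scale[of "u+v" "1/2"] add that V(1) by (simp add: subspace_add)
    then have "2 * J u + 2 * J v = 4 * J ?w + inner (u - v) (u - v)"
      unfolding J_def by (simp add: inner_simps algebra_simps inner_commute)
    then show ?thesis
      using m_le[OF w] by simp
  qed
  have "Cauchy x"
  proof (rule metric_CauchyI)
    fix e :: real assume "e > 0"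
    obtain N where N: "1 / Suc N < e\<^sup>2 / 4"
      using nat_approx_posE[of "e\<^sup>2/4"] \<open>e > 0\<close> by auto
    have "dist (x i) (x j) < e" if "i \<ge> N" "j \<ge> N" for i j
    proof -
      have "1 / Suc i \<le> 1 / Suc N" "1 / Suc j \<le> 1 / Suc N"
        using that by (auto simp: frac_le)
      then have "(dist (x i) (x j))\<^sup>2 < e\<^sup>2"
        using par[OF x(1) x(1), of i j] x(2)[of i] x(2)[of j] N
        by (simp add: dist_norm power2_norm_eq_inner)
      then show ?thesis
        using \<open>e > 0\<close> by (simp add: power2_less_imp_less)
    qed
    then show "\<exists>M. \<forall>i\<ge>M. \<forall>j\<ge>M. dist (x i) (x j) < e"
      by blast
  qed
  then obtain y where y: "x \<longlonglongrightarrow> y"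
    using Cauchy_convergent convergent_def by blast
  then have yV: "y \<in> V"
    using closed_sequentially[OF V(2)] x(1) by blast
  have fx: "(\<lambda>n. f (x n)) \<longlonglongrightarrow> f y"
  proof (rule Lim_null[THEN iffD2, OF Lim_null_comparison])
    show "\<forall>\<^sub>F n in sequentially. norm (f (x n) - f y) \<le> K * norm (x n - y)"
      using bound[of "x n - y" for n] x(1) yV V(1) by (auto simp: diff[symmetric] subspace_diff)
    show "(\<lambda>n. K * norm (x n - y)) \<longlonglongrightarrow> 0"
      using tendsto_mult_right_zero[OF tendsto_norm_zero[OF y[THEN Lim_null[THEN iffD1]]]] .
  qed
  have Jy: "J y \<le> m"
  proof (rule LIMSEQ_le)
    show "(\<lambda>n. J (x n)) \<longlonglongrightarrow> J y"
      unfolding J_def by (intro tendsto_intros y fx)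
    show "(\<lambda>n. m + 1 / Suc n) \<longlonglongrightarrow> m"
      using tendsto_add[OF tendsto_const[of m] LIMSEQ_inverse_real_of_nat] by (simp add: inverse_eq_divide)
    show "\<exists>N. \<forall>n\<ge>N. J (x n) \<le> m + 1 / Suc n"
      using x(2) less_imp_le by blast
  qed
  have "inner y z = f z" if z: "z \<in> V" for z
  proof -
    define d where "d = inner y z - f z"
    have quad: "0 \<le> 2 * t * d + t\<^sup>2 * inner z z" for t
    proof -
      have "J (y + t *\<^sub>R z) = J y + 2 * t * d + t\<^sup>2 * inner z z"
        using add[of y "t *\<^sub>R z"] scale[of z t] z yV V(1)
        unfolding J_def d_def
        by (simp add: inner_simps algebra_simps inner_commute power2_eq_square subspace_scale)
      moreover have "m \<le> J (y + t *\<^sub>R z)"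
        using m_le z yV V(1) by (simp add: subspace_scale subspace_add)
      ultimately show ?thesis
        using Jy by linarith
    qed
    \<comment> \<open>This \<open>t\<close> makes the quadratic polynomial negative unless \<open>d = 0\<close>.\<close>
    define k where "k = inner z z"
    have k: "k \<ge> 0"
      by (simp add: k_def)
    have "2 * (- d / (k + 1)) * d + (- d / (k + 1))\<^sup>2 * k = - (d\<^sup>2 * (k + 2)) / (k + 1)\<^sup>2"
      using k by (simp add: divide_simps power2_eq_square) (simp add: algebra_simps)
    then have "0 \<le> - (d\<^sup>2 * (k + 2)) / (k + 1)\<^sup>2"
      using quad[of "- d / (k + 1)"] by (simp add: k_def)
    then have "d\<^sup>2 * (k + 2) \<le> 0"
      using k by (simp add: divide_le_0_iff)
    then have "d\<^sup>2 \<le> 0"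
      using k by (simp add: mult_le_0_iff)
    then show ?thesis by (simp add: d_def)
  qed
  then show ?thesis
    using yV by blast
qed

lemma riesz_representation:
  fixes V :: "'a::chilbert_space set" and f :: "'a \<Rightarrow> complex"
  assumes V: "csubspace V" "closed V" and f: "f \<in> dual_on V norm"
  shows "\<exists>y\<in>V. \<forall>z\<in>V. cinner y z = f z"
proof -
  obtain C where C: "\<And>x. x \<in> V \<Longrightarrow> cmod (f x) \<le> C * norm x"
    using f unfolding dual_on_def by blast
  have add: "\<And>x y. x \<in> V \<Longrightarrow> y \<in> V \<Longrightarrow> f (x + y) = f x + f y"
    and scale: "\<And>c x. x \<in> V \<Longrightarrow> f (c *\<^sub>C x) = c * f x"
    using f by (auto simp: dual_on_def clinear_on_def scaleC_complex_def)
  have "\<exists>y\<in>V. \<forall>z\<in>V. inner y z = Re (f z)"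
  proof (rule riesz_representation_real)
    show "\<bar>Re (f x)\<bar> \<le> C * norm x" if "x \<in> V" for x
      using C[OF that] abs_Re_le_cmod order_trans by blast
  qed (use V csubspace_imp_subspace in \<open>auto simp: add scale scaleR_scaleC\<close>)
  then obtain y where y: "y \<in> V" "\<And>z. z \<in> V \<Longrightarrow> inner y z = Re (f z)"
    by blast
  have "cinner y z = f z" if "z \<in> V" for z
    using y(2)[OF that] y(2)[OF csubspace_scaleC[OF V(1) that, of \<i>]] that
    by (simp add: complex_eq_iff inner_eq_Re_cinner cinner_scaleC_right scale)
  then show ?thesis
    using y(1) by blast
qed

lemma orthogonal_unique:
  assumes "subspace V" "x \<in> V" "y \<in> V" "\<And>z. z \<in> V \<Longrightarrow> inner x z = inner y z"
  shows "x = y"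
proof -
  have "inner (x - y) (x - y) = 0"
    using assms subspace_diff[OF assms(1-3)] by (simp add: inner_diff_left)
  then show ?thesis by simp
qed

text \<open>
  The description defining \<open>emb_adj\<close> is proper for a closed subspace, because \<open>\<langle>x, \<cdot>\<rangle>\<close> has a Riesz
  representative there: the orthogonal projection of \<open>x\<close>.
\<close>

lemma emb_adj:
  fixes V :: "'a::chilbert_space set"
  assumes V: "csubspace V" "closed V"
  shows emb_adj_in: "emb_adj V x \<in> V"
    and cinner_emb_adj: "z \<in> V \<Longrightarrow> cinner (emb_adj V x) z = cinner x z"
proof -
  have "cinner x \<in> dual_on V norm"
    using norm_cinner_le[of x]
    by (auto simp: dual_on_def clinear_on_def cinner_add_right cinner_scaleC_right
        scaleC_complex_def intro!: exI[of _ "norm x"])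
  then obtain y where y: "y \<in> V" "\<forall>z\<in>V. cinner y z = cinner x z"
    using riesz_representation[OF V] by blast
  have "emb_adj V x \<in> V \<and> (\<forall>z\<in>V. cinner (emb_adj V x) z = cinner x z)"
    unfolding emb_adj_def
  proof (rule theI[of _ y])
    show "y \<in> V \<and> (\<forall>z\<in>V. cinner y z = cinner x z)"
      using y by blast
    show "w = y" if "w \<in> V \<and> (\<forall>z\<in>V. cinner w z = cinner x z)" for w
      using that y orthogonal_unique[OF csubspace_imp_subspace[OF V(1)]]
      by (simp add: inner_eq_Re_cinner)
  qed
  then show "emb_adj V x \<in> V" and "z \<in> V \<Longrightarrow> cinner (emb_adj V x) z = cinner x z"
    by simp_all
qed

context
  fixes V :: "'a::chilbert_space set"
  assumes V: "csubspace V" "closed V"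
begin

lemma inner_emb_adj: "z \<in> V \<Longrightarrow> inner (emb_adj V x) z = inner x z"
  by (simp add: inner_eq_Re_cinner cinner_emb_adj[OF V])

lemma emb_adj_unique:
  assumes "y \<in> V" "\<And>z. z \<in> V \<Longrightarrow> inner y z = inner x z"
  shows "emb_adj V x = y"
  using orthogonal_unique[OF csubspace_imp_subspace[OF V(1)] emb_adj_in[OF V] assms(1)] assms(2)
  by (simp add: inner_emb_adj)

lemma emb_adj_eq_0: "(\<And>z. z \<in> V \<Longrightarrow> inner x z = 0) \<Longrightarrow> emb_adj V x = 0"
  using V(1) by (intro emb_adj_unique) (auto simp: csubspace_def)

lemma emb_adj_add: "emb_adj V (x + y) = emb_adj V x + emb_adj V y"
  using csubspace_imp_subspace[OF V(1)]
  by (intro emb_adj_unique) (auto simp: inner_add_left inner_emb_adj emb_adj_in[OF V] subspace_add)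

lemma emb_adj_scaleR: "emb_adj V (r *\<^sub>R x) = r *\<^sub>R emb_adj V x"
  using csubspace_imp_subspace[OF V(1)]
  by (intro emb_adj_unique) (auto simp: inner_emb_adj emb_adj_in[OF V] subspace_scale)

lemma emb_adj_diff: "emb_adj V (x - y) = emb_adj V x - emb_adj V y"
  using emb_adj_add[of "x - y" y] by simp

lemma norm_emb_adj_le: "norm (emb_adj V x) \<le> norm x"
proof -
  have "(norm (emb_adj V x))\<^sup>2 = inner x (emb_adj V x)"
    using inner_emb_adj[of "emb_adj V x" x] emb_adj_in[OF V] by (simp add: power2_norm_eq_inner)
  also have "\<dots> \<le> norm x * norm (emb_adj V x)"
    by (rule norm_cauchy_schwarz)
  finally show ?thesis
    by (cases "emb_adj V x = 0") (auto simp: power2_eq_square)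
qed

text \<open>
  By Riesz every bounded functional on \<open>V\<close> is \<open>\<langle>y, \<cdot>\<rangle>\<close> for some \<open>y \<in> V\<close>, and its real and imaginary parts
  are real inner products with \<open>y\<close> and \<open>\<i> y\<close>.  From here on weak limits are real.
\<close>

lemma weakly_converges_on_norm_iff:
  "weakly_converges_on V norm x l \<longleftrightarrow>
    (\<forall>n. x n \<in> V) \<and> l \<in> V \<and> (\<forall>w. (\<lambda>n. inner w (x n)) \<longlonglongrightarrow> inner w l)"
proof (intro iffI conjI allI)
  assume *: "weakly_converges_on V norm x l"
  then show "x n \<in> V" "l \<in> V" for n
    by (auto simp: weakly_converges_on_def)
  fix w
  have "cinner w \<in> dual_on V norm"
    using norm_cinner_le[of w]
    by (auto simp: dual_on_def clinear_on_def cinner_add_right cinner_scaleC_right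
        scaleC_complex_def intro!: exI[of _ "norm w"])
  then have "(\<lambda>n. cinner w (x n)) \<longlonglongrightarrow> cinner w l"
    using * by (auto simp: weakly_converges_on_def)
  then show "(\<lambda>n. inner w (x n)) \<longlonglongrightarrow> inner w l"
    unfolding inner_eq_Re_cinner by (rule tendsto_Re)
next
  assume *: "(\<forall>n. x n \<in> V) \<and> l \<in> V \<and> (\<forall>w. (\<lambda>n. inner w (x n)) \<longlonglongrightarrow> inner w l)"
  show "weakly_converges_on V norm x l"
    unfolding weakly_converges_on_def
  proof (intro conjI ballI)
    fix f :: "'a \<Rightarrow> complex" assume "f \<in> dual_on V norm"
    then obtain y where "\<forall>z\<in>V. cinner y z = f z"
      using riesz_representation[OF V] by blast
    moreover have "(\<lambda>n. cinner y (x n)) \<longlonglongrightarrow> cinner y l"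
      unfolding cinner_eq_Complex using * by (intro tendsto_Complex) auto
    ultimately show "(\<lambda>n. f (x n)) \<longlonglongrightarrow> f l"
      using * by simp
  qed (use * in auto)
qed

end

lemma csubspace_UNIV: "csubspace UNIV"
  by (simp add: csubspace_def)

lemmas weakly_converges_iff =
  weakly_converges_on_norm_iff[OF csubspace_UNIV closed_UNIV, simplified]

section \<open>Coercive operators\<close>

text \<open>
  The Lax--Milgram lemma: for small \<open>t > 0\<close> coercivity makes \<open>x \<mapsto> x - t (T x - y)\<close> a contraction of \<open>V\<close>,
  whose fixed point solves \<open>T x = y\<close>.
\<close>

lemma lax_milgram:
  fixes V :: "'a::{real_inner, complete_space} set"
  assumes V: "subspace V" "closed V"
    and T: "\<And>x. x \<in> V \<Longrightarrow> T x \<in> V"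
    and diff: "\<And>x y. x \<in> V \<Longrightarrow> y \<in> V \<Longrightarrow> T (x - y) = T x - T y"
    and bound: "\<And>x. x \<in> V \<Longrightarrow> norm (T x) \<le> M * norm x"
    and coercive: "\<And>x. x \<in> V \<Longrightarrow> c * (norm x)\<^sup>2 \<le> inner (T x) x" and "c > 0"
  shows "bij_betw T V V"
proof -
  have "\<exists>!x\<in>V. T x = y" if y: "y \<in> V" for y
  proof -
    define N where "N = max M c"
    have boundN: "norm (T x) \<le> N * norm x" if "x \<in> V" for x
      using bound[OF that] mult_right_mono[of M N "norm x"] by (auto simp: N_def intro: order_trans)
    have N_pos: "c \<le> N" "0 < N"
      using \<open>c > 0\<close> by (auto simp: N_def)
    define t where "t = c / N\<^sup>2"
    define q where "q = 1 - c\<^sup>2 / N\<^sup>2"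
    have "t > 0"
      using N_pos \<open>c > 0\<close> by (simp add: t_def)
    have "c\<^sup>2 \<le> N\<^sup>2"
      using N_pos \<open>c > 0\<close> by (simp add: power_mono)
    then have q: "0 \<le> q" "q < 1"
      using N_pos \<open>c > 0\<close> by (auto simp: q_def)
    have "\<exists>!x\<in>V. x - t *\<^sub>R (T x - y) = x"
    proof (rule Banach_fix[where c="sqrt q"])
      show "complete V"
        using V(2) by (simp add: complete_eq_closed)
      show "V \<noteq> {}"
        using V(1) subspace_0 by auto
      show "0 \<le> sqrt q" "sqrt q < 1"
        using q by auto
      show "(\<lambda>x. x - t *\<^sub>R (T x - y)) ` V \<subseteq> V"
        using T y V(1) by (auto intro!: subspace_diff subspace_scale)
      fix u v assume uv: "u \<in> V" "v \<in> V"
      define w where "w = u - v"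
      have w: "w \<in> V"
        using uv V(1) by (simp add: w_def subspace_diff)
      have "u - t *\<^sub>R (T u - y) - (v - t *\<^sub>R (T v - y)) = w - t *\<^sub>R T w"
        unfolding w_def diff[OF uv] by (simp add: algebra_simps)
      then have "(dist (u - t *\<^sub>R (T u - y)) (v - t *\<^sub>R (T v - y)))\<^sup>2 = (norm (w - t *\<^sub>R T w))\<^sup>2"
        by (simp add: dist_norm)
      also have "\<dots> = (norm w)\<^sup>2 - 2 * t * inner (T w) w + t\<^sup>2 * (norm (T w))\<^sup>2"
        unfolding power2_norm_eq_inner
        by (simp add: inner_simps algebra_simps inner_commute power2_eq_square)
      also have "\<dots> \<le> (norm w)\<^sup>2 - 2 * t * (c * (norm w)\<^sup>2) + t\<^sup>2 * (N * norm w)\<^sup>2"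
        using coercive[OF w] boundN[OF w] \<open>t > 0\<close>
        by (intro add_mono diff_mono mult_left_mono power_mono) auto
      also have "\<dots> = q * (norm w)\<^sup>2"
        using N_pos by (simp add: q_def t_def power2_eq_square field_simps)
      finally have "(dist (u - t *\<^sub>R (T u - y)) (v - t *\<^sub>R (T v - y)))\<^sup>2 \<le> (sqrt q * dist u v)\<^sup>2"
        using q by (simp add: power_mult_distrib w_def dist_norm)
      then show "dist (u - t *\<^sub>R (T u - y)) (v - t *\<^sub>R (T v - y)) \<le> sqrt q * dist u v"
        by (rule power2_le_imp_le) (use q in auto)
    qed
    then show ?thesis
      using \<open>t > 0\<close> by simp
  qed
  then show ?thesis
    using T unfolding bij_betw_def inj_on_def by (metis image_subset_iff subset_antisym subsetI image_iff)
qed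

section \<open>Closed operators with closed range\<close>

text \<open>
  Zabreiko's lemma: a countably subadditive seminorm on a Banach space is continuous.  By Baire's
  theorem some sublevel set of \<open>p\<close> is dense in a ball, so every vector is approximated
  arbitrarily well by vectors with controlled seminorm; summing successive corrections turns this
  into an exact bound.
\<close>

lemma countably_subadditive_seminorm_bounded:
  fixes Y :: "'a::{real_normed_vector, complete_space} set" and p :: "'a \<Rightarrow> real"
  assumes Y: "subspace Y" "closed Y"
    and p_add: "\<And>x y. x \<in> Y \<Longrightarrow> y \<in> Y \<Longrightarrow> p (x + y) \<le> p x + p y"
    and p_scale: "\<And>r x. x \<in> Y \<Longrightarrow> p (r *\<^sub>R x) = \<bar>r\<bar> * p x"
    and p_sums: "\<And>w s. (\<And>n. w n \<in> Y) \<Longrightarrow> w sums s \<Longrightarrow> s \<in> Y \<Longrightarrow> summable (\<lambda>n. p (w n)) \<Longrightarrow>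
      p s \<le> (\<Sum>n. p (w n))"
  shows "\<exists>C. \<forall>y\<in>Y. p y \<le> C * norm y"
proof -
  have p0: "p 0 = 0"
    using p_scale[of 0 0] Y(1) by (simp add: subspace_0)
  have p_nonneg: "0 \<le> p x" if "x \<in> Y" for x
    using p_add[of x "(-1) *\<^sub>R x"] p_scale[of x "-1"] that Y(1) p0 by (simp add: subspace_neg)
  define F where "F n = closure {y \<in> Y. p y \<le> real n}" for n :: nat
  have FY: "F n \<subseteq> Y" for n
    unfolding F_def using Y(2) by (intro closure_minimal) auto
  have Un: "(\<Union>n. F n) = Y"
  proof -
    have "y \<in> (\<Union>n. F n)" if "y \<in> Y" for y
    proof -
      obtain n :: nat where "p y \<le> real n"
        using real_arch_simple by blast
      then have "y \<in> F n"
        unfolding F_def using that by (intro subsetD[OF closure_subset]) simp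
      then show ?thesis by blast
    qed
    then show ?thesis using FY by blast
  qed
  have "\<exists>n. top_of_set Y interior_of F n \<noteq> {}"
  proof (rule ccontr)
    assume "\<not> ?thesis"
    moreover have "closedin (top_of_set Y) (F n)" for n
      using FY by (simp add: F_def closed_subset)
    ultimately have "top_of_set Y interior_of \<Union>(range F) = {}"
      using Y(2) completely_metrizable_space_closedin[OF completely_metrizable_space_euclidean, of Y]
      by (intro Baire_category_alt) auto
    then have "Y = {}"
      using Un interior_of_topspace[of "top_of_set Y"] by simp
    then show False
      using Y(1) subspace_0 by auto
  qed
  then obtain n x where n: "x \<in> top_of_set Y interior_of F n"
    by blast
  then obtain r where x: "x \<in> Y" and r: "r > 0" "cball x r \<inter> Y \<subseteq> F n"
  proof -
    have "openin (top_of_set Y) (top_of_set Y interior_of F n)"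
      by simp
    then have "top_of_set Y interior_of F n \<subseteq> Y"
      "\<exists>e>0. cball x e \<inter> Y \<subseteq> top_of_set Y interior_of F n"
      using n unfolding openin_contains_cball by auto
    moreover have "top_of_set Y interior_of F n \<subseteq> F n"
      by (rule interior_of_subset)
    ultimately show ?thesis
      using n that by blast
  qed
  have approx1: "\<exists>w\<in>Y. p w \<le> n \<and> norm (y - w) < e" if y: "y \<in> Y" "norm y \<le> r" and "e > 0" for y e
  proof -
    have "x + y \<in> F n" "x - y \<in> F n"
      using r(2) y x Y(1) by (auto simp: subset_iff dist_norm subspace_add subspace_diff)
    then obtain u v where u: "u \<in> Y" "p u \<le> n" "dist u (x + y) < e"
      and v: "v \<in> Y" "p v \<le> n" "dist v (x - y) < e"
      using \<open>e > 0\<close> unfolding F_def closure_approachable by blast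
    \<comment> \<open>\<open>y\<close> is the midpoint of \<open>x + y\<close> and \<open>- (x - y)\<close>.\<close>
    let ?w = "(1/2) *\<^sub>R (u - v)"
    have "p (u - v) \<le> p u + p v"
      using p_add[of u "(-1) *\<^sub>R v"] p_scale[of v "-1"] u v Y(1) by (simp add: subspace_neg)
    then have "p ?w \<le> n"
      using p_scale[of "u - v" "1/2"] u v Y(1) by (simp add: subspace_diff)
    moreover have "norm (y - ?w) < e"
    proof -
      have "y - ?w = (1/2) *\<^sub>R ((v - (x - y)) - (u - (x + y)))"
        by (simp add: algebra_simps flip: scaleR_left_distrib)
      then have "norm (y - ?w) \<le> (1/2) * (norm (v - (x - y)) + norm (u - (x + y)))"
        using norm_triangle_ineq4[of "v - (x - y)" "u - (x + y)"] by simp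
      then show ?thesis
        using u(3) v(3) by (simp add: dist_norm)
    qed
    moreover have "?w \<in> Y"
      using u v Y(1) by (simp add: subspace_diff subspace_scale)
    ultimately show ?thesis by blast
  qed
  define K where "K = n / r"
  have "K \<ge> 0"
    using r by (simp add: K_def)
  have approx: "\<exists>w\<in>Y. p w \<le> K * norm y \<and> norm (y - w) \<le> e" if y: "y \<in> Y" and "e > 0" for y e
  proof (cases "y = 0")
    case True
    then show ?thesis
      using Y(1) subspace_0 p0 \<open>e > 0\<close> by (intro bexI[of _ 0]) auto
  next
    case False
    define t where "t = r / norm y"
    have t: "t > 0"
      using False r by (simp add: t_def)
    obtain w where w: "w \<in> Y" "p w \<le> n" "norm (t *\<^sub>R y - w) < t * e"
      using approx1[of "t *\<^sub>R y" "t * e"] y Y(1) False r t \<open>e > 0\<close> by (auto simp: t_def subspace_scale)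
    have "p ((1/t) *\<^sub>R w) \<le> K * norm y"
      using p_scale[OF w(1), of "1/t"] w(2) t r False by (simp add: t_def K_def field_simps)
    moreover have "norm (y - (1/t) *\<^sub>R w) \<le> e"
    proof -
      have "y - (1/t) *\<^sub>R w = (1/t) *\<^sub>R (t *\<^sub>R y - w)"
        using t by (simp add: scaleR_diff_right)
      then have "norm (y - (1/t) *\<^sub>R w) = norm (t *\<^sub>R y - w) / t"
        using t by simp
      also have "\<dots> \<le> t * e / t"
        using w(3) t by (intro divide_right_mono) auto
      finally show ?thesis
        using t by simp
    qed
    ultimately show ?thesis
      using w(1) Y(1) by (meson subspace_scale)
  qed
  then obtain W where W: "\<And>y e. y \<in> Y \<Longrightarrow> e > 0 \<Longrightarrow> W y e \<in> Y \<and> p (W y e) \<le> K * norm y \<and> norm (y - W y e) \<le> e"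
    by metis
  have "p y \<le> 2 * K * norm y" if y: "y \<in> Y" for y
  proof (cases "y = 0")
    case False
    define R where "R = rec_nat y (\<lambda>k z. z - W z (norm y / 2 ^ Suc k))"
    define w where "w k = W (R k) (norm y / 2 ^ Suc k)" for k
    have R0: "R 0 = y" and RS: "R (Suc k) = R k - w k" for k
      by (simp_all add: R_def w_def)
    have eps: "norm y / 2 ^ k > 0" for k
      using False by simp
    have R: "R k \<in> Y \<and> norm (R k) \<le> norm y / 2 ^ k" for k
    proof (induction k)
      case (Suc k)
      then show ?case
        using W[of "R k" "norm y / 2 ^ Suc k"] eps[of "Suc k"] Y(1)
        unfolding RS w_def by (auto simp: subspace_diff)
    qed (use y R0 in auto)
    have wY: "w k \<in> Y" and pw: "p (w k) \<le> K * norm y * (1/2) ^ k" for k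
    proof -
      show "w k \<in> Y"
        using W[of "R k" "norm y / 2 ^ Suc k"] R eps[of "Suc k"] unfolding w_def by blast
      have "p (w k) \<le> K * norm (R k)"
        using W[of "R k" "norm y / 2 ^ Suc k"] R eps[of "Suc k"] unfolding w_def by blast
      also have "\<dots> \<le> K * (norm y / 2 ^ k)"
        using R \<open>K \<ge> 0\<close> by (intro mult_left_mono) auto
      finally show "p (w k) \<le> K * norm y * (1/2) ^ k"
        by (simp add: power_divide)
    qed
    have partial: "(\<Sum>k<m. w k) = y - R m" for m
      by (induction m) (auto simp: R0 RS)
    have "R \<longlonglongrightarrow> 0"
    proof (rule Lim_null_comparison)
      show "\<forall>\<^sub>F k in sequentially. norm (R k) \<le> norm y * (1/2) ^ k"
        using R by (simp add: power_divide)
      show "(\<lambda>k. norm y * (1/2) ^ k) \<longlonglongrightarrow> 0"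
        by (intro tendsto_mult_right_zero LIMSEQ_power_zero) auto
    qed
    then have "w sums y"
      unfolding sums_def partial using tendsto_diff[OF tendsto_const[of y]] by fastforce
    have geo: "(\<lambda>k. K * norm y * (1/2) ^ k) sums (K * norm y * 2)"
      using sums_mult[OF geometric_sums[of "1/2::real"], of "K * norm y"] by simp
    have sm: "summable (\<lambda>k. p (w k))"
      using summable_comparison_test'[OF sums_summable[OF geo], of 0 "\<lambda>k. p (w k)"]
        pw p_nonneg[OF wY] by simp
    have "p y \<le> (\<Sum>k. p (w k))"
      by (rule p_sums) (use wY \<open>w sums y\<close> y sm in auto)
    also have "\<dots> \<le> K * norm y * 2"
      using suminf_le[OF pw sm sums_summable[OF geo]] sums_unique[OF geo] by simp
    finally show ?thesis by simp
  qed (simp add: p0)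
  then show ?thesis by blast
qed

instance chilbert_space \<subseteq> banach ..

lemma densely_defined_closedD:
  assumes "densely_defined_closed A"
  shows csubspace_op_dom: "csubspace (op_dom A)"
    and clinear_on_op_app: "clinear_on (op_dom A) (op_app A)"
    and op_dom_dense: "closure (op_dom A) = UNIV"
  using assms by (auto simp: densely_defined_closed_def)

lemma closed_graphD:
  assumes "densely_defined_closed A"
    and "\<And>n. x n \<in> op_dom A" "x \<longlonglongrightarrow> u" "(\<lambda>n. op_app A (x n)) \<longlonglongrightarrow> v"
  shows "u \<in> op_dom A \<and> op_app A u = v"
proof -
  have "closed {(x, op_app A x) |x. x \<in> op_dom A}"
    using assms(1) by (simp add: densely_defined_closed_def)
  moreover have "(x n, op_app A (x n)) \<in> {(x, op_app A x) |x. x \<in> op_dom A}" for n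
    using assms(2) by blast
  moreover have "(\<lambda>n. (x n, op_app A (x n))) \<longlonglongrightarrow> (u, v)"
    by (intro tendsto_Pair assms)
  ultimately have "(u, v) \<in> {(x, op_app A x) |x. x \<in> op_dom A}"
    by (rule closed_sequentially)
  then show ?thesis by auto
qed

lemma csubspace_op_ran:
  assumes "csubspace (op_dom A)" "clinear_on (op_dom A) (op_app A)"
  shows "csubspace (op_ran A)"
  unfolding csubspace_def
proof (intro conjI ballI allI)
  show "0 \<in> op_ran A"
    using assms clinear_on_zero[OF assms] unfolding op_ran_def csubspace_def by (metis imageI)
next
  fix x y assume "x \<in> op_ran A" "y \<in> op_ran A"
  then obtain u v where "u \<in> op_dom A" "v \<in> op_dom A" "x = op_app A u" "y = op_app A v"
    by (auto simp: op_ran_def)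
  then show "x + y \<in> op_ran A"
    using assms unfolding op_ran_def csubspace_def clinear_on_def by (metis imageI)
next
  fix c x assume "x \<in> op_ran A"
  then obtain u where "u \<in> op_dom A" "x = op_app A u"
    by (auto simp: op_ran_def)
  then show "c *\<^sub>C x \<in> op_ran A"
    using assms unfolding op_ran_def csubspace_def clinear_on_def by (metis imageI)
qed

lemma csubspace_op_ker:
  fixes A :: "('a::complex_inner, 'b::complex_inner) pop"
  assumes "csubspace (op_dom A)" "clinear_on (op_dom A) (op_app A)"
  shows "csubspace (op_ker A)"
proof -
  have "c *\<^sub>C (0::'b) = 0" for c
    using norm_scaleC[of c "0::'b"] by simp
  then show ?thesis
    using assms clinear_on_zero[OF assms] unfolding csubspace_def op_ker_def clinear_on_def
    by auto
qed

lemma closed_op_ker: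
  assumes "densely_defined_closed A"
  shows "closed (op_ker A)"
proof -
  have "u \<in> op_ker A" if "\<forall>n. x n \<in> op_ker A" "x \<longlonglongrightarrow> u" for x u
    using closed_graphD[OF assms, of x u 0] that by (auto simp: op_ker_def)
  then show ?thesis
    by (auto simp: closed_sequential_limits)
qed

context
  fixes A :: "('a::chilbert_space, 'b::chilbert_space) pop"
  assumes A: "densely_defined_closed A"
begin

lemmas dom_A = csubspace_op_dom[OF A] and lin_A = clinear_on_op_app[OF A]
lemmas sub_dom_A = csubspace_imp_subspace[OF dom_A]
lemmas ker_A = csubspace_op_ker[OF dom_A lin_A] closed_op_ker[OF A]
lemmas app_diff = clinear_on_diff[OF dom_A lin_A]

lemma orthogonal_preimage:
  assumes "y \<in> op_ran A"
  shows "\<exists>x\<in>op_dom A. op_app A x = y \<and> (\<forall>z\<in>op_ker A. inner x z = 0)"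
proof -
  obtain x where x: "x \<in> op_dom A" "op_app A x = y"
    using assms by (auto simp: op_ran_def)
  define k where "k = emb_adj (op_ker A) x"
  have k: "k \<in> op_dom A" "op_app A k = 0"
    using emb_adj_in[OF ker_A, of x] by (auto simp: k_def op_ker_def)
  then show ?thesis
    using x sub_dom_A inner_emb_adj[OF ker_A, of _ x]
    by (intro bexI[of _ "x - k"])
      (auto simp: app_diff subspace_diff inner_diff_left k_def)
qed

lemma orthogonal_preimage_choice:
  obtains S where "\<And>y. y \<in> op_ran A \<Longrightarrow> S y \<in> op_dom A"
    and "\<And>y. y \<in> op_ran A \<Longrightarrow> op_app A (S y) = y"
    and "\<And>y z. y \<in> op_ran A \<Longrightarrow> z \<in> op_ker A \<Longrightarrow> inner (S y) z = 0"
proof -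
  have "\<forall>y\<in>op_ran A. \<exists>x. x \<in> op_dom A \<and> op_app A x = y \<and> (\<forall>z\<in>op_ker A. inner x z = 0)"
    using orthogonal_preimage by blast
  then obtain S where "\<forall>y\<in>op_ran A. S y \<in> op_dom A \<and> op_app A (S y) = y \<and>
      (\<forall>z\<in>op_ker A. inner (S y) z = 0)"
    by (auto dest: bchoice)
  then show thesis
    by (intro that[of S]) simp_all
qed

lemma orthogonal_preimage_unique:
  assumes "x \<in> op_dom A" "x' \<in> op_dom A" "op_app A x = op_app A x'"
    and "\<And>z. z \<in> op_ker A \<Longrightarrow> inner x z = 0" "\<And>z. z \<in> op_ker A \<Longrightarrow> inner x' z = 0"
  shows "x = x'"
proof -
  have "x - x' \<in> op_ker A"
    using assms sub_dom_A by (auto simp: op_ker_def app_diff subspace_diff)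
  then have "inner (x - x') (x - x') = 0"
    using assms(4,5) by (simp add: inner_diff_left)
  then show ?thesis by simp
qed

text \<open>
  The norm of the preimage orthogonal to the kernel is a seminorm on the range.  It is countably
  subadditive because the graph is closed, and hence bounded.
\<close>

lemma bounded_below_on_orthogonal_of_kernel:
  assumes ran: "closed (op_ran A)"
  shows "\<exists>C. \<forall>x\<in>op_dom A. (\<forall>z\<in>op_ker A. inner x z = 0) \<longrightarrow> norm x \<le> C * norm (op_app A x)"
proof -
  have ran_sub: "subspace (op_ran A)"
    by (rule csubspace_imp_subspace[OF csubspace_op_ran[OF dom_A lin_A]])
  have add: "op_app A (x + y) = op_app A x + op_app A y" if "x \<in> op_dom A" "y \<in> op_dom A" for x y
    using lin_A that by (simp add: clinear_on_def)
  have scale: "op_app A (r *\<^sub>R x) = r *\<^sub>R op_app A x" if "x \<in> op_dom A" for x r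
    using lin_A that by (simp add: clinear_on_def scaleR_scaleC)
  obtain S where S: "\<And>y. y \<in> op_ran A \<Longrightarrow> S y \<in> op_dom A"
    "\<And>y. y \<in> op_ran A \<Longrightarrow> op_app A (S y) = y"
    "\<And>y z. y \<in> op_ran A \<Longrightarrow> z \<in> op_ker A \<Longrightarrow> inner (S y) z = 0"
    by (rule orthogonal_preimage_choice) blast
  have S_eq: "S y = x" if "x \<in> op_dom A" "op_app A x = y" "\<And>z. z \<in> op_ker A \<Longrightarrow> inner x z = 0" for x y
  proof -
    have "y \<in> op_ran A"
      using that by (auto simp: op_ran_def)
    then show ?thesis
      using orthogonal_preimage_unique S that by auto
  qed
  have "\<exists>C. \<forall>y\<in>op_ran A. norm (S y) \<le> C * norm y"
  proof (rule countably_subadditive_seminorm_bounded[OF ran_sub ran])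
    fix x y assume "x \<in> op_ran A" "y \<in> op_ran A"
    then have "S (x + y) = S x + S y"
      using S sub_dom_A by (intro S_eq) (auto simp: add subspace_add inner_add_left)
    then show "norm (S (x + y)) \<le> norm (S x) + norm (S y)"
      by (simp add: norm_triangle_ineq)
  next
    fix r x assume "x \<in> op_ran A"
    then have "S (r *\<^sub>R x) = r *\<^sub>R S x"
      using S sub_dom_A by (intro S_eq) (auto simp: scale subspace_scale)
    then show "norm (S (r *\<^sub>R x)) = \<bar>r\<bar> * norm (S x)"
      by simp
  next
    fix w s assume w: "\<And>n. w n \<in> op_ran A" and s: "w sums s" "s \<in> op_ran A"
      and sm: "summable (\<lambda>n. norm (S (w n)))"
    define X where "X m = (\<Sum>n<m. S (w n))" for m
    have X: "X m \<in> op_dom A \<and> op_app A (X m) = (\<Sum>n<m. w n)" for m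
    proof (induction m)
      case 0
      then show ?case
        using clinear_on_zero[OF dom_A lin_A] sub_dom_A by (simp add: X_def subspace_0)
    next
      case (Suc m)
      then show ?case
        using S w sub_dom_A by (simp add: X_def add subspace_add)
    qed
    have lim: "X \<longlonglongrightarrow> (\<Sum>n. S (w n))"
      using summable_LIMSEQ[OF summable_norm_cancel[OF sm]] unfolding X_def .
    moreover have "(\<lambda>m. op_app A (X m)) \<longlonglongrightarrow> s"
      using s(1) X by (simp add: sums_def)
    ultimately have *: "(\<Sum>n. S (w n)) \<in> op_dom A \<and> op_app A (\<Sum>n. S (w n)) = s"
      using closed_graphD[OF A, of X] X by blast
    have "inner (\<Sum>n. S (w n)) z = 0" if "z \<in> op_ker A" for z
    proof -
      have "(\<lambda>m. inner (X m) z) \<longlonglongrightarrow> inner (\<Sum>n. S (w n)) z"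
        by (intro tendsto_intros lim)
      moreover have "inner (X m) z = 0" for m
        using S(3)[OF w that] by (simp add: X_def inner_sum_left)
      ultimately show ?thesis
        by (simp add: LIMSEQ_const_iff)
    qed
    then have "S s = (\<Sum>n. S (w n))"
      using * by (intro S_eq) auto
    then show "norm (S s) \<le> (\<Sum>n. norm (S (w n)))"
      using summable_norm[OF sm] by simp
  qed
  then obtain C where C: "\<And>y. y \<in> op_ran A \<Longrightarrow> norm (S y) \<le> C * norm y"
    by blast
  have "norm x \<le> C * norm (op_app A x)" if "x \<in> op_dom A" "\<forall>z\<in>op_ker A. inner x z = 0" for x
    using C[of "op_app A x"] S_eq[of x "op_app A x"] that by (auto simp: op_ran_def)
  then show ?thesis by blast
qed

lemma op_adj_unique:
  assumes "\<And>x. x \<in> op_dom A \<Longrightarrow> inner z x = inner z' x"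
  shows "z = z'"
proof -
  have "closure (op_dom A) \<subseteq> {x. inner (z - z') x = 0}"
  proof (rule closure_minimal)
    show "closed {x. inner (z - z') x = 0}"
      by (intro closed_Collect_eq continuous_intros)
  qed (use assms in \<open>auto simp: inner_diff_left\<close>)
  then have "inner (z - z') (z - z') = 0"
    using op_dom_dense[OF A] by blast
  then show ?thesis by simp
qed

lemma op_adjI:
  assumes "\<And>x. x \<in> op_dom A \<Longrightarrow> cinner y (op_app A x) = cinner z x"
  shows "y \<in> op_dom (op_adj A)" "op_app (op_adj A) y = z"
proof -
  show "y \<in> op_dom (op_adj A)"
    using assms by (auto simp: op_adj_def)
  have "(THE z. \<forall>x\<in>op_dom A. cinner y (op_app A x) = cinner z x) = z"
    using assms by (intro the_equality ballI op_adj_unique) (auto simp: inner_eq_Re_cinner)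
  then show "op_app (op_adj A) y = z"
    by (simp add: op_adj_def)
qed

lemma cinner_op_adj:
  assumes "y \<in> op_dom (op_adj A)" "x \<in> op_dom A"
  shows "cinner y (op_app A x) = cinner (op_app (op_adj A) y) x"
proof -
  obtain z where "\<And>x. x \<in> op_dom A \<Longrightarrow> cinner y (op_app A x) = cinner z x"
    using assms(1) by (auto simp: op_adj_def)
  then show ?thesis
    using op_adjI(2)[of y z] assms(2) by simp
qed

lemma op_adj_linear:
  shows csubspace_op_dom_adj: "csubspace (op_dom (op_adj A))"
    and clinear_on_op_adj: "clinear_on (op_dom (op_adj A)) (op_app (op_adj A))"
proof -
  have "0 \<in> op_dom (op_adj A)"
    by (rule op_adjI(1)[of _ 0]) auto
  moreover have "x + y \<in> op_dom (op_adj A) \<and>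
      op_app (op_adj A) (x + y) = op_app (op_adj A) x + op_app (op_adj A) y"
    if "x \<in> op_dom (op_adj A)" "y \<in> op_dom (op_adj A)" for x y
    using op_adjI[of "x + y" "op_app (op_adj A) x + op_app (op_adj A) y"] that
    by (simp add: cinner_add_left cinner_op_adj)
  moreover have "c *\<^sub>C x \<in> op_dom (op_adj A) \<and>
      op_app (op_adj A) (c *\<^sub>C x) = c *\<^sub>C op_app (op_adj A) x"
    if "x \<in> op_dom (op_adj A)" for c x
    using op_adjI[of "c *\<^sub>C x" "c *\<^sub>C op_app (op_adj A) x"] that
    by (simp add: cinner_scaleC_left cinner_op_adj)
  ultimately show "csubspace (op_dom (op_adj A))"
    "clinear_on (op_dom (op_adj A)) (op_app (op_adj A))"
    by (auto simp: csubspace_def clinear_on_def)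
qed

text \<open>
  A vector \<open>w\<close> orthogonal to the kernel defines a functional \<open>A x \<mapsto> \<langle>w, x\<rangle>\<close> on the range, bounded
  because \<open>A\<close> is bounded below on \<open>(ker A)\<^sup>\<bottom>\<close>.  Its Riesz representative is a preimage of \<open>w\<close> under the
  adjoint, and lies in the range of \<open>A\<close>.  This gives the closed range theorem.
\<close>

lemma op_adj_preimage:
  assumes ran: "closed (op_ran A)" and w: "\<And>x. x \<in> op_ker A \<Longrightarrow> inner w x = 0"
  shows "\<exists>y\<in>op_dom (op_adj A) \<inter> op_ran A. op_app (op_adj A) y = w"
proof -
  obtain C where C: "\<And>x. x \<in> op_dom A \<Longrightarrow> \<forall>z\<in>op_ker A. inner x z = 0 \<Longrightarrow> norm x \<le> C * norm (op_app A x)"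
    using bounded_below_on_orthogonal_of_kernel[OF ran] by blast
  obtain S where S: "\<And>y. y \<in> op_ran A \<Longrightarrow> S y \<in> op_dom A"
    "\<And>y. y \<in> op_ran A \<Longrightarrow> op_app A (S y) = y"
    "\<And>y z. y \<in> op_ran A \<Longrightarrow> z \<in> op_ker A \<Longrightarrow> inner (S y) z = 0"
    by (rule orthogonal_preimage_choice) blast
  have "\<forall>z\<in>op_ker A. cinner w z = cinner 0 z"
    using w by (subst cinner_eq_on_iff_inner_eq_on[OF ker_A(1)]) auto
  then have w': "cinner w x = cinner w x'"
    if "x \<in> op_dom A" "x' \<in> op_dom A" "op_app A x = op_app A x'" for x x'
  proof -
    have "x - x' \<in> op_ker A"
      using that sub_dom_A by (auto simp: op_ker_def app_diff subspace_diff)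
    with \<open>\<forall>z\<in>op_ker A. cinner w z = cinner 0 z\<close> have "cinner w (x - x') = 0"
      by simp
    then show ?thesis
      by (simp add: cinner_diff_right)
  qed
  have ranA: "csubspace (op_ran A)"
    by (rule csubspace_op_ran[OF dom_A lin_A])
  have "(\<lambda>y. cinner w (S y)) \<in> dual_on (op_ran A) norm"
    unfolding dual_on_def clinear_on_def
  proof (intro CollectI conjI ballI allI exI[of _ "norm w * C"])
    fix x y assume xy: "x \<in> op_ran A" "y \<in> op_ran A"
    have "cinner w (S (x + y)) = cinner w (S x + S y)"
    proof (intro w')
      have xy_ran: "x + y \<in> op_ran A"
        using xy csubspace_imp_subspace[OF ranA] by (simp add: subspace_add)
      have "op_app A (S x + S y) = op_app A (S x) + op_app A (S y)"
        using lin_A S(1)[OF xy(1)] S(1)[OF xy(2)] by (simp add: clinear_on_def)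
      then show "op_app A (S (x + y)) = op_app A (S x + S y)"
        by (simp add: S(2)[OF xy_ran] S(2)[OF xy(1)] S(2)[OF xy(2)])
      show "S (x + y) \<in> op_dom A" "S x + S y \<in> op_dom A"
        using S(1)[OF xy_ran] S(1)[OF xy(1)] S(1)[OF xy(2)] sub_dom_A by (simp_all add: subspace_add)
    qed
    then show "cinner w (S (x + y)) = cinner w (S x) + cinner w (S y)"
      by (simp add: cinner_add_right)
  next
    fix c x assume x: "x \<in> op_ran A"
    have "cinner w (S (c *\<^sub>C x)) = cinner w (c *\<^sub>C S x)"
    proof (intro w')
      have cx: "c *\<^sub>C x \<in> op_ran A"
        by (rule csubspace_scaleC[OF ranA x])
      have "op_app A (c *\<^sub>C S x) = c *\<^sub>C op_app A (S x)"
        using lin_A S(1)[OF x] by (simp add: clinear_on_def)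
      then show "op_app A (S (c *\<^sub>C x)) = op_app A (c *\<^sub>C S x)"
        by (simp add: S(2)[OF cx] S(2)[OF x])
      show "S (c *\<^sub>C x) \<in> op_dom A" "c *\<^sub>C S x \<in> op_dom A"
        using S(1)[OF cx] csubspace_scaleC[OF dom_A S(1)[OF x]] .
    qed
    then show "cinner w (S (c *\<^sub>C x)) = c *\<^sub>C cinner w (S x)"
      by (simp add: cinner_scaleC_right scaleC_complex_def)
  next
    fix x assume x: "x \<in> op_ran A"
    have "cmod (cinner w (S x)) \<le> norm w * norm (S x)"
      by (rule norm_cinner_le)
    also have "\<dots> \<le> norm w * (C * norm x)"
    proof (rule mult_left_mono)
      show "norm (S x) \<le> C * norm x"
        using C[of "S x"] S(1)[OF x] S(2)[OF x] S(3)[OF x] by simp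
    qed simp
    finally show "cmod (cinner w (S x)) \<le> norm w * C * norm x"
      by simp
  qed
  then obtain y where y: "y \<in> op_ran A" "\<And>z. z \<in> op_ran A \<Longrightarrow> cinner y z = cinner w (S z)"
    using riesz_representation[OF ranA ran] by blast
  have y_adj: "cinner y (op_app A x) = cinner w x" if "x \<in> op_dom A" for x
  proof -
    have ran_x: "op_app A x \<in> op_ran A"
      using that by (simp add: op_ran_def)
    then have "cinner y (op_app A x) = cinner w (S (op_app A x))"
      by (rule y(2))
    also have "\<dots> = cinner w x"
      using S(1,2)[OF ran_x] that by (intro w') auto
    finally show ?thesis .
  qed
  show ?thesis
    using op_adjI(1)[OF y_adj] op_adjI(2)[OF y_adj] y(1)
    by - (rule bexI[of _ y], assumption, rule IntI, assumption+)
qed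

lemma op_ran_adj:
  assumes "closed (op_ran A)"
  shows "op_ran (op_adj A) = {w. \<forall>x\<in>op_ker A. inner w x = 0}"
proof
  show "op_ran (op_adj A) \<subseteq> {w. \<forall>x\<in>op_ker A. inner w x = 0}"
  proof
    fix w assume "w \<in> op_ran (op_adj A)"
    then obtain y where y: "y \<in> op_dom (op_adj A)" "w = op_app (op_adj A) y"
      unfolding op_ran_def by blast
    have "inner w x = 0" if "x \<in> op_ker A" for x
      using cinner_op_adj[OF y(1), of x] that y(2) by (simp add: op_ker_def inner_eq_Re_cinner)
    then show "w \<in> {w. \<forall>x\<in>op_ker A. inner w x = 0}"
      by blast
  qed
  show "{w. \<forall>x\<in>op_ker A. inner w x = 0} \<subseteq> op_ran (op_adj A)"
  proof
    fix w assume "w \<in> {w. \<forall>x\<in>op_ker A. inner w x = 0}"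
    then obtain y where "y \<in> op_dom (op_adj A)" "op_app (op_adj A) y = w"
      using op_adj_preimage[OF assms, of w] by auto
    then show "w \<in> op_ran (op_adj A)"
      unfolding op_ran_def by blast
  qed
qed

lemma closed_op_ran_adj:
  assumes "closed (op_ran A)"
  shows "closed (op_ran (op_adj A))"
proof -
  have "closed {w. inner w x = 0}" for x :: 'a
    by (intro closed_Collect_eq continuous_intros)
  then show ?thesis
    unfolding op_ran_adj[OF assms] by (simp add: Collect_ball_eq closed_INT)
qed

end

section \<open>The reduced operators\<close>

text \<open>
  The common shape of the two reduced operators: restricted to \<open>R\<close>, the operator \<open>B\<close> becomes an
  isomorphism onto its range \<open>V\<close>, for the graph norm because \<open>B\<close> is bounded below there.
\<close>

definition reduced_iso ::
  "('a::complex_inner, 'b::complex_inner) pop \<Rightarrow> 'a set \<Rightarrow> 'b set \<Rightarrow> bool"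
  where "reduced_iso B R V \<longleftrightarrow>
    csubspace (op_dom B) \<and> clinear_on (op_dom B) (op_app B) \<and> csubspace R \<and> op_ran B = V \<and>
    bij_betw (op_app B) (op_dom B \<inter> R) V \<and>
    (\<exists>C. \<forall>x\<in>op_dom B \<inter> R. norm x \<le> C * norm (op_app B x))"

lemma reduced_iso_operator:
  fixes A :: "('a::chilbert_space, 'b::chilbert_space) pop"
  assumes A: "densely_defined_closed A" and ran: "closed (op_ran A)"
  shows "reduced_iso A (op_ran (op_adj A)) (op_ran A)"
  unfolding reduced_iso_def
proof (intro conjI)
  show "csubspace (op_ran (op_adj A))"
    by (intro csubspace_op_ran csubspace_op_dom_adj clinear_on_op_adj A)
  show "bij_betw (op_app A) (op_dom A \<inter> op_ran (op_adj A)) (op_ran A)"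
    unfolding bij_betw_def
  proof
    show "inj_on (op_app A) (op_dom A \<inter> op_ran (op_adj A))"
      unfolding op_ran_adj[OF A ran] by (auto intro!: inj_onI orthogonal_preimage_unique[OF A])
    have "y \<in> op_app A ` (op_dom A \<inter> op_ran (op_adj A))" if "y \<in> op_ran A" for y
    proof -
      obtain x where "x \<in> op_dom A" "op_app A x = y" "\<forall>z\<in>op_ker A. inner x z = 0"
        using orthogonal_preimage[OF A \<open>y \<in> op_ran A\<close>] by auto
      then show ?thesis
        unfolding op_ran_adj[OF A ran] by (intro image_eqI[of _ _ x]) simp_all
    qed
    then show "op_app A ` (op_dom A \<inter> op_ran (op_adj A)) = op_ran A"
      by (auto simp: op_ran_def)
  qed
  show "\<exists>C. \<forall>x\<in>op_dom A \<inter> op_ran (op_adj A). norm x \<le> C * norm (op_app A x)"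
  proof -
    obtain C where C: "\<forall>x\<in>op_dom A. (\<forall>z\<in>op_ker A. inner x z = 0) \<longrightarrow> norm x \<le> C * norm (op_app A x)"
      using bounded_below_on_orthogonal_of_kernel[OF A ran] ..
    then show ?thesis
      unfolding op_ran_adj[OF A ran] by (intro exI[of _ C]) simp
  qed
qed (use A in \<open>auto simp: csubspace_op_dom clinear_on_op_app\<close>)

lemma reduced_iso_adjoint:
  fixes A :: "('a::chilbert_space, 'b::chilbert_space) pop"
  assumes A: "densely_defined_closed A" and ran: "closed (op_ran A)"
  shows "reduced_iso (op_adj A) (op_ran A) (op_ran (op_adj A))"
proof -
  obtain C where C: "\<And>x. x \<in> op_dom A \<Longrightarrow> \<forall>z\<in>op_ker A. inner x z = 0 \<Longrightarrow> norm x \<le> C * norm (op_app A x)"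
    using bounded_below_on_orthogonal_of_kernel[OF A ran] by blast
  \<comment> \<open>With \<open>y = A x\<close> and \<open>x\<close> orthogonal to the kernel,
    \<open>|y|\<^sup>2 = \<langle>A\<^sup>* y, x\<rangle> \<le> |A\<^sup>* y| \<sqdot> C |y|\<close>.\<close>
  have bound: "norm y \<le> C * norm (op_app (op_adj A) y)" if y: "y \<in> op_dom (op_adj A) \<inter> op_ran A" for y
  proof (cases "y = 0")
    case True
    then show ?thesis
      using clinear_on_zero[OF csubspace_op_dom_adj[OF A] clinear_on_op_adj[OF A]] by simp
  next
    case False
    obtain x where x: "x \<in> op_dom A" "op_app A x = y" "\<forall>z\<in>op_ker A. inner x z = 0"
      using orthogonal_preimage[OF A, of y] y by auto
    have "norm y * norm y = inner (op_app (op_adj A) y) x"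
      using cinner_op_adj[OF A, of y x] x y
      by (simp add: inner_eq_Re_cinner flip: power2_eq_square) (simp add: power2_norm_eq_inner inner_eq_Re_cinner)
    also have "\<dots> \<le> norm (op_app (op_adj A) y) * norm x"
      by (rule norm_cauchy_schwarz)
    also have "\<dots> \<le> norm (op_app (op_adj A) y) * (C * norm y)"
      using C[of x] x by (intro mult_left_mono) auto
    finally have "norm y * norm y \<le> norm y * (C * norm (op_app (op_adj A) y))"
      by (simp add: ac_simps)
    then show ?thesis
      using False by (auto dest: mult_left_le_imp_le)
  qed
  have sub: "subspace (op_dom (op_adj A))" "subspace (op_ran A)"
    using csubspace_op_dom_adj[OF A] csubspace_op_ran[OF csubspace_op_dom[OF A] clinear_on_op_app[OF A]]
    by (auto intro: csubspace_imp_subspace)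
  show ?thesis
    unfolding reduced_iso_def
  proof (intro conjI)
    show "csubspace (op_ran A)"
      by (intro csubspace_op_ran csubspace_op_dom clinear_on_op_app A)
    show "bij_betw (op_app (op_adj A)) (op_dom (op_adj A) \<inter> op_ran A) (op_ran (op_adj A))"
      unfolding bij_betw_def
    proof
      show "inj_on (op_app (op_adj A)) (op_dom (op_adj A) \<inter> op_ran A)"
      proof (rule inj_onI)
        fix x y assume xy: "x \<in> op_dom (op_adj A) \<inter> op_ran A" "y \<in> op_dom (op_adj A) \<inter> op_ran A"
          "op_app (op_adj A) x = op_app (op_adj A) y"
        then have "op_app (op_adj A) (x - y) = 0"
          using clinear_on_diff[OF csubspace_op_dom_adj[OF A] clinear_on_op_adj[OF A]] by simp
        then show "x = y"
          using bound[of "x - y"] xy sub by (simp add: subspace_diff)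
      qed
      have "w \<in> op_app (op_adj A) ` (op_dom (op_adj A) \<inter> op_ran A)" if "w \<in> op_ran (op_adj A)" for w
      proof -
        obtain y where "y \<in> op_dom (op_adj A) \<inter> op_ran A" "op_app (op_adj A) y = w"
          using op_adj_preimage[OF A ran, of w] \<open>w \<in> op_ran (op_adj A)\<close>
          unfolding op_ran_adj[OF A ran] by auto
        then show ?thesis by blast
      qed
      then show "op_app (op_adj A) ` (op_dom (op_adj A) \<inter> op_ran A) = op_ran (op_adj A)"
        by (auto simp: op_ran_def)
    qed
    show "\<exists>C. \<forall>x\<in>op_dom (op_adj A) \<inter> op_ran A. norm x \<le> C * norm (op_app (op_adj A) x)"
      using bound by blast
  qed (use A in \<open>auto simp: csubspace_op_dom_adj clinear_on_op_adj\<close>)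
qed

section \<open>Compressions and the variational problems\<close>

definition compr :: "'a::complex_inner set \<Rightarrow> ('a \<Rightarrow> 'a) \<Rightarrow> 'a \<Rightarrow> 'a"
  where "compr V b x = emb_adj V (b x)"

definition compr_inv :: "'a::complex_inner set \<Rightarrow> ('a \<Rightarrow> 'a) \<Rightarrow> 'a \<Rightarrow> 'a"
  where "compr_inv V b = inv_into V (compr V b)"

definition weak_lim :: "(nat \<Rightarrow> 'a::real_inner) \<Rightarrow> 'a \<Rightarrow> bool"
  where "weak_lim x l \<longleftrightarrow> (\<forall>w. (\<lambda>n. inner w (x n)) \<longlonglongrightarrow> inner w l)"

lemma weak_lim_unique:
  assumes "weak_lim x l" "weak_lim x l'"
  shows "l = l'"
proof -
  have "inner (l - l') l = inner (l - l') l'"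
    using assms LIMSEQ_unique unfolding weak_lim_def by metis
  then have "inner (l - l') (l - l') = 0"
    by (simp add: inner_diff_right)
  then show ?thesis by simp
qed

lemma weak_lim_const: "weak_lim (\<lambda>n. l) l"
  by (simp add: weak_lim_def)

lemma weak_lim_add: "weak_lim x l \<Longrightarrow> weak_lim y m \<Longrightarrow> weak_lim (\<lambda>n. x n + y n) (l + m)"
  by (simp add: weak_lim_def inner_add_right tendsto_add)

lemma weak_lim_diff: "weak_lim x l \<Longrightarrow> weak_lim y m \<Longrightarrow> weak_lim (\<lambda>n. x n - y n) (l - m)"
  by (simp add: weak_lim_def inner_diff_right tendsto_diff)

lemma weak_lim_emb_adj:
  fixes V :: "'a::chilbert_space set"
  assumes V: "csubspace V" "closed V" and "weak_lim x l"
  shows "weak_lim (\<lambda>n. emb_adj V (x n)) (emb_adj V l)"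
proof -
  have "inner w (emb_adj V y) = inner (emb_adj V w) y" for w y
    using inner_emb_adj[OF V emb_adj_in[OF V, of y], of w]
      inner_emb_adj[OF V emb_adj_in[OF V, of w], of y]
    by (simp add: inner_commute)
  then show ?thesis
    using assms(3) by (simp add: weak_lim_def)
qed

lemma weakly_converges_on_iff_weak_lim:
  fixes V :: "'a::chilbert_space set"
  assumes "csubspace V" "closed V"
  shows "weakly_converges_on V norm x l \<longleftrightarrow> (\<forall>n. x n \<in> V) \<and> l \<in> V \<and> weak_lim x l"
  unfolding weakly_converges_on_norm_iff[OF assms] weak_lim_def ..

lemma compr_inv:
  assumes "bij_betw (compr V b) V V" "F \<in> V"
  shows "compr_inv V b F \<in> V" "compr V b (compr_inv V b F) = F"
  using assms unfolding compr_inv_def bij_betw_def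
  by (auto simp: inv_into_into f_inv_into_f)

lemma compr_inv_eq:
  assumes "bij_betw (compr V b) V V" "x \<in> V" "compr V b x = F"
  shows "compr_inv V b F = x"
  using assms unfolding compr_inv_def bij_betw_def by auto

text \<open>
  On the reduced domain the graph norm of \<open>\<phi>\<close> is dominated by the norm of \<open>B \<phi>\<close>, so \<open>f\<close> transported to \<open>V\<close>
  by the inverse of \<open>B\<close> stays bounded, and Riesz applies in \<open>V\<close>.
\<close>

lemma reduced_dual_representation:
  fixes B :: "('a::complex_inner, 'b::chilbert_space) pop"
  assumes iso: "reduced_iso B R V" and V: "csubspace V" "closed V"
    and f: "f \<in> dual_on (op_dom B \<inter> R) (graph_norm B)"
  shows "\<exists>F\<in>V. \<forall>\<phi>\<in>op_dom B \<inter> R. f \<phi> = cinner F (op_app B \<phi>)"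
proof -
  let ?D = "op_dom B \<inter> R"
  have sub: "csubspace (op_dom B)" "csubspace R" and lin: "clinear_on (op_dom B) (op_app B)"
    and bij: "bij_betw (op_app B) ?D V"
    using iso by (auto simp: reduced_iso_def)
  obtain C where C: "\<And>x. x \<in> ?D \<Longrightarrow> norm x \<le> C * norm (op_app B x)"
    using iso unfolding reduced_iso_def by blast
  obtain K where K: "\<And>x. x \<in> ?D \<Longrightarrow> cmod (f x) \<le> K * graph_norm B x"
    using f unfolding dual_on_def by blast
  have f_lin: "clinear_on ?D f"
    using f by (simp add: dual_on_def)
  define S where "S = inv_into ?D (op_app B)"
  have S: "S y \<in> ?D" "op_app B (S y) = y" if "y \<in> V" for y
    using bij that unfolding S_def bij_betw_def by (metis inv_into_into, metis f_inv_into_f)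
  have S_app: "S (op_app B x) = x" if "x \<in> ?D" for x
    using bij that unfolding S_def bij_betw_def by simp
  have "(\<lambda>y. f (S y)) \<in> dual_on V norm"
    unfolding dual_on_def clinear_on_def
  proof (intro CollectI conjI ballI allI exI[of _ "\<bar>K\<bar> * sqrt (C\<^sup>2 + 1)"])
    fix x y assume xy: "x \<in> V" "y \<in> V"
    have D: "S x + S y \<in> ?D"
      using S(1)[OF xy(1)] S(1)[OF xy(2)] sub by (auto simp: csubspace_def)
    have "op_app B (S x + S y) = x + y"
      using lin S[OF xy(1)] S[OF xy(2)] by (simp add: clinear_on_def)
    then have "S (x + y) = S x + S y"
      using S_app[OF D] by simp
    then show "f (S (x + y)) = f (S x) + f (S y)"
      using f_lin S(1)[OF xy(1)] S(1)[OF xy(2)] by (simp add: clinear_on_def)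
  next
    fix c x assume x: "x \<in> V"
    have D: "c *\<^sub>C S x \<in> ?D"
      using S(1)[OF x] sub by (auto simp: csubspace_def)
    have "op_app B (c *\<^sub>C S x) = c *\<^sub>C x"
      using lin S[OF x] by (simp add: clinear_on_def)
    then have "S (c *\<^sub>C x) = c *\<^sub>C S x"
      using S_app[OF D] by simp
    then show "f (S (c *\<^sub>C x)) = c *\<^sub>C f (S x)"
      using f_lin S(1)[OF x] by (simp add: clinear_on_def)
  next
    fix x assume x: "x \<in> V"
    have "(norm (S x))\<^sup>2 \<le> (C * norm x)\<^sup>2"
      using C[OF S(1)[OF x]] S(2)[OF x] by (intro power_mono) auto
    then have "graph_norm B (S x) \<le> sqrt ((C\<^sup>2 + 1) * (norm x)\<^sup>2)"
      unfolding graph_norm_def S(2)[OF x] by (simp add: power_mult_distrib algebra_simps)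
    then have gn: "graph_norm B (S x) \<le> sqrt (C\<^sup>2 + 1) * norm x"
      by (simp add: real_sqrt_mult)
    have gn0: "0 \<le> graph_norm B (S x)"
      by (simp add: graph_norm_def)
    have "cmod (f (S x)) \<le> K * graph_norm B (S x)"
      by (rule K[OF S(1)[OF x]])
    also have "\<dots> \<le> \<bar>K\<bar> * graph_norm B (S x)"
      using gn0 by (intro mult_right_mono) auto
    also have "\<dots> \<le> \<bar>K\<bar> * (sqrt (C\<^sup>2 + 1) * norm x)"
      using gn by (intro mult_left_mono) auto
    finally show "cmod (f (S x)) \<le> \<bar>K\<bar> * sqrt (C\<^sup>2 + 1) * norm x"
      by simp
  qed
  then obtain F where F: "F \<in> V" "\<forall>z\<in>V. cinner F z = f (S z)"
    using riesz_representation[OF V] by blast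
  have "f \<phi> = cinner F (op_app B \<phi>)" if "\<phi> \<in> ?D" for \<phi>
    using F(2) bij S_app[OF that] that by (auto simp: bij_betw_def)
  then show ?thesis
    using F(1) by blast
qed

lemma cinner_op_app_dual:
  fixes B :: "('a::complex_inner, 'b::complex_inner) pop"
  assumes "clinear_on (op_dom B) (op_app B)" "D \<subseteq> op_dom B"
  shows "(\<lambda>\<phi>. cinner F (op_app B \<phi>)) \<in> dual_on D (graph_norm B)"
  unfolding dual_on_def clinear_on_def
proof (intro CollectI conjI ballI allI exI[of _ "norm F"])
  fix x assume "x \<in> D"
  have "cmod (cinner F (op_app B x)) \<le> norm F * norm (op_app B x)"
    by (rule norm_cinner_le)
  also have "\<dots> \<le> norm F * graph_norm B x"
    unfolding graph_norm_def by (intro mult_left_mono real_le_rsqrt) auto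
  finally show "cmod (cinner F (op_app B x)) \<le> norm F * graph_norm B x" .
next
  fix x y assume "x \<in> D" "y \<in> D"
  then have "x \<in> op_dom B" "y \<in> op_dom B" using assms(2) by auto
  then show "cinner F (op_app B (x + y)) = cinner F (op_app B x) + cinner F (op_app B y)"
    using assms(1) by (simp add: clinear_on_def cinner_add_right)
next
  fix c x assume "x \<in> D"
  then have "x \<in> op_dom B" using assms(2) by blast
  then show "cinner F (op_app B (c *\<^sub>C x)) = c *\<^sub>C cinner F (op_app B x)"
    using assms(1) by (simp add: clinear_on_def cinner_scaleC_right scaleC_complex_def)
qed

lemma satisfies_eq_iff_emb_adj:
  fixes B :: "('a::complex_inner, 'b::chilbert_space) pop"
  assumes iso: "reduced_iso B R V" and V: "csubspace V" "closed V"
    and F: "F \<in> V" "\<And>\<phi>. \<phi> \<in> op_dom B \<inter> R \<Longrightarrow> f \<phi> = cinner F (op_app B \<phi>)"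
  shows "satisfies_eq b (op_restrict B R) f u \<longleftrightarrow> emb_adj V (b (op_app B u)) = F"
proof -
  have V_eq: "V = op_app B ` (op_dom B \<inter> R)"
    using iso by (auto simp: reduced_iso_def bij_betw_def)
  have "satisfies_eq b (op_restrict B R) f u \<longleftrightarrow> (\<forall>z\<in>V. cinner (b (op_app B u)) z = cinner F z)"
    using F(2) by (simp add: satisfies_eq_def op_restrict_def V_eq)
  also have "\<dots> \<longleftrightarrow> emb_adj V (b (op_app B u)) = F"
  proof
    assume "\<forall>z\<in>V. cinner (b (op_app B u)) z = cinner F z"
    then show "emb_adj V (b (op_app B u)) = F"
      by (intro emb_adj_unique[OF V F(1)]) (simp add: inner_eq_Re_cinner)
  next
    assume "emb_adj V (b (op_app B u)) = F"
    then show "\<forall>z\<in>V. cinner (b (op_app B u)) z = cinner F z"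
      using cinner_emb_adj[OF V] by metis
  qed
  finally show ?thesis .
qed

text \<open>
  A functional on the whole domain restricts to the reduced domain, where it is represented by a
  vector of \<open>V\<close>; so weak convergence of the images suffices.
\<close>

lemma weakly_converges_graph_norm:
  fixes B :: "('a::complex_inner, 'b::chilbert_space) pop"
  assumes iso: "reduced_iso B R V" and V: "csubspace V" "closed V"
    and x: "\<And>n. x n \<in> op_dom B \<inter> R" and u: "u \<in> op_dom B \<inter> R"
    and lim: "weak_lim (\<lambda>n. op_app B (x n)) (op_app B u)"
  shows "weakly_converges_on (op_dom B) (graph_norm B) x u"
  unfolding weakly_converges_on_def
proof (intro conjI allI ballI)
  fix f assume "f \<in> dual_on (op_dom B) (graph_norm B)"
  then have "f \<in> dual_on (op_dom B \<inter> R) (graph_norm B)"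
    unfolding dual_on_def clinear_on_def by blast
  then obtain F where F: "\<forall>\<phi>\<in>op_dom B \<inter> R. f \<phi> = cinner F (op_app B \<phi>)"
    using reduced_dual_representation[OF iso V] by blast
  have "(\<lambda>n. cinner F (op_app B (x n))) \<longlonglongrightarrow> cinner F (op_app B u)"
    unfolding cinner_eq_Complex using lim by (intro tendsto_Complex) (auto simp: weak_lim_def)
  then show "(\<lambda>n. f (x n)) \<longlonglongrightarrow> f u"
    using F x u by simp
qed (use x u in auto)

lemma weak_lim_op_app:
  fixes B :: "('a::complex_inner, 'b::complex_inner) pop"
  assumes "clinear_on (op_dom B) (op_app B)"
    and "weakly_converges_on (op_dom B) (graph_norm B) x u"
  shows "weak_lim (\<lambda>n. op_app B (x n)) (op_app B u)"
  unfolding weak_lim_def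
proof
  fix w
  have "(\<lambda>n. cinner w (op_app B (x n))) \<longlonglongrightarrow> cinner w (op_app B u)"
    using assms(2) cinner_op_app_dual[OF assms(1) order_refl, of w]
    unfolding weakly_converges_on_def by auto
  then show "(\<lambda>n. inner w (op_app B (x n))) \<longlonglongrightarrow> inner w (op_app B u)"
    unfolding inner_eq_Re_cinner by (rule tendsto_Re)
qed

text \<open>
  Nonlocal H-convergence consists of two conditions of the following form, one for \<open>a\<close> and \<open>A\<^sub>0\<close>, one
  for \<open>a\<^sup>-\<^sup>1\<close> and \<open>A\<^sub>1\<^sup>*\<close>.
\<close>

definition variational_convergence ::
  "('a::complex_inner, 'b::complex_inner) pop \<Rightarrow> 'a set \<Rightarrow> (nat \<Rightarrow> 'b \<Rightarrow> 'b) \<Rightarrow> ('b \<Rightarrow> 'b) \<Rightarrow>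
    ('a \<Rightarrow> complex) \<Rightarrow> (nat \<Rightarrow> 'a) \<Rightarrow> bool"
  where "variational_convergence B R bn b f un \<longleftrightarrow>
    (\<exists>u. weakly_converges_on (op_dom B) (graph_norm B) un u \<and>
      weakly_converges_on UNIV norm (\<lambda>n. bn n (op_app B (un n))) (b (op_app B u)) \<and>
      satisfies_eq b (op_restrict B R) f u)"

definition variational_solutions ::
  "('a::complex_inner, 'b::complex_inner) pop \<Rightarrow> 'a set \<Rightarrow> (nat \<Rightarrow> 'b \<Rightarrow> 'b) \<Rightarrow>
    ('a \<Rightarrow> complex) \<Rightarrow> (nat \<Rightarrow> 'a) \<Rightarrow> bool"
  where "variational_solutions B R bn f un \<longleftrightarrow>
    (\<forall>n. un n \<in> op_dom B \<inter> R \<and> satisfies_eq (bn n) (op_restrict B R) f (un n))"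

lemma op_restrict_simps:
  "op_dom (op_restrict B R) = op_dom B \<inter> R"
  "op_app (op_restrict B R) = op_app B"
  "graph_norm (op_restrict B R) = graph_norm B"
  by (simp_all add: graph_norm_def op_restrict_def fun_eq_iff)

text \<open>
  The two limits in the definition are independent, so its conclusion splits into one statement for
  each variational problem.
\<close>

lemma nonlocally_H_converges_unfold:
  "nonlocally_H_converges A0 A1 an a \<longleftrightarrow>
    (\<forall>f\<in>dual_on (op_dom A0 \<inter> op_ran (op_adj A0)) (graph_norm A0).
     \<forall>g\<in>dual_on (op_dom (op_adj A1) \<inter> op_ran A1) (graph_norm (op_adj A1)).
     \<forall>un vn. variational_solutions A0 (op_ran (op_adj A0)) an f un \<and>
       variational_solutions (op_adj A1) (op_ran A1) (\<lambda>n. inv (an n)) g vn \<longrightarrow>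
       variational_convergence A0 (op_ran (op_adj A0)) an a f un \<and>
       variational_convergence (op_adj A1) (op_ran A1) (\<lambda>n. inv (an n)) (inv a) g vn)"
proof -
  have ex: "(\<exists>u v. P u \<and> Q v \<and> P' u \<and> Q' v \<and> P'' u \<and> Q'' v) \<longleftrightarrow>
      (\<exists>u. P u \<and> P' u \<and> P'' u) \<and> (\<exists>v. Q v \<and> Q' v \<and> Q'' v)" for P P' P'' Q Q' Q''
    by blast
  show ?thesis
    unfolding nonlocally_H_converges_def variational_convergence_def variational_solutions_def
      red_def red_adj_def ex op_restrict_simps ..
qed

lemma variational_solutions_exist:
  fixes B :: "('a::complex_inner, 'b::chilbert_space) pop"
  assumes iso: "reduced_iso B R V" and V: "csubspace V" "closed V"
    and bij: "\<And>n. bij_betw (compr V (bn n)) V V"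
    and f: "f \<in> dual_on (op_dom B \<inter> R) (graph_norm B)"
  shows "\<exists>un. variational_solutions B R bn f un"
proof -
  obtain F where F: "F \<in> V" "\<And>\<phi>. \<phi> \<in> op_dom B \<inter> R \<Longrightarrow> f \<phi> = cinner F (op_app B \<phi>)"
    using reduced_dual_representation[OF iso V f] by blast
  have "\<exists>u\<in>op_dom B \<inter> R. satisfies_eq (bn n) (op_restrict B R) f u" for n
  proof -
    have "compr_inv V (bn n) F \<in> op_app B ` (op_dom B \<inter> R)"
      using compr_inv(1)[OF bij F(1)] iso by (simp add: reduced_iso_def bij_betw_def)
    then obtain u where u: "u \<in> op_dom B \<inter> R" "compr_inv V (bn n) F = op_app B u" ..
    then have "emb_adj V (bn n (op_app B u)) = F"
      using compr_inv(2)[OF bij F(1), of n] by (simp add: compr_def)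
    then show ?thesis
      using u(1) satisfies_eq_iff_emb_adj[OF iso V F] by blast
  qed
  then show ?thesis
    unfolding variational_solutions_def by metis
qed

text \<open>
  Since \<open>B u\<^sub>n = (b\<^sub>n)\<^sub>V\<^sup>-\<^sup>1 F\<close>, where \<open>F\<close> represents \<open>f\<close>, the convergence of the solutions is a statement
  about the inverse compressions only.
\<close>

lemma variational_convergence_iff:
  fixes B :: "('a::complex_inner, 'b::chilbert_space) pop"
  assumes iso: "reduced_iso B R V" and V: "csubspace V" "closed V"
    and bij: "\<And>n. bij_betw (compr V (bn n)) V V"
  shows "(\<forall>f\<in>dual_on (op_dom B \<inter> R) (graph_norm B). \<forall>un.
      variational_solutions B R bn f un \<longrightarrow> variational_convergence B R bn b f un) \<longleftrightarrow>
    (\<forall>F\<in>V. \<exists>p\<in>V. weak_lim (\<lambda>n. compr_inv V (bn n) F) p \<and>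
      weak_lim (\<lambda>n. bn n (compr_inv V (bn n) F)) (b p) \<and> compr V b p = F)"
    (is "?L = ?R")
proof -
  have lin: "clinear_on (op_dom B) (op_app B)" and ran: "op_app B ` op_dom B = V"
    and img: "op_app B ` (op_dom B \<inter> R) = V"
    using iso by (auto simp: reduced_iso_def op_ran_def bij_betw_def)
  have sol: "op_app B (un n) = compr_inv V (bn n) F"
    if F: "F \<in> V" "\<And>\<phi>. \<phi> \<in> op_dom B \<inter> R \<Longrightarrow> f \<phi> = cinner F (op_app B \<phi>)"
      and un: "variational_solutions B R bn f un" for f F un n
  proof -
    have "emb_adj V (bn n (op_app B (un n))) = F"
      using un satisfies_eq_iff_emb_adj[OF iso V F] by (simp add: variational_solutions_def)
    moreover have "op_app B (un n) \<in> V"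
      using un img by (auto simp: variational_solutions_def)
    ultimately show ?thesis
      using compr_inv_eq[OF bij, of "op_app B (un n)" n F] by (simp add: compr_def)
  qed
  show ?thesis
  proof
    assume L: ?L
    show ?R
    proof
      fix F assume F: "F \<in> V"
      define f where "f \<phi> = cinner F (op_app B \<phi>)" for \<phi>
      have f: "f \<in> dual_on (op_dom B \<inter> R) (graph_norm B)"
        unfolding f_def by (rule cinner_op_app_dual[OF lin]) simp
      have Ff: "\<And>\<phi>. \<phi> \<in> op_dom B \<inter> R \<Longrightarrow> f \<phi> = cinner F (op_app B \<phi>)"
        by (simp add: f_def)
      obtain un where un: "variational_solutions B R bn f un"
        using variational_solutions_exist[where bn=bn, OF iso V bij f] by blast
      then have "variational_convergence B R bn b f un"
        using L f by blast
      then obtain u where u: "weakly_converges_on (op_dom B) (graph_norm B) un u"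
        "weakly_converges_on UNIV norm (\<lambda>n. bn n (op_app B (un n))) (b (op_app B u))"
        "satisfies_eq b (op_restrict B R) f u"
        by (auto simp: variational_convergence_def)
      have "u \<in> op_dom B"
        using u(1) by (simp add: weakly_converges_on_def)
      then have "op_app B u \<in> V"
        using ran by blast
      moreover have "weak_lim (\<lambda>n. compr_inv V (bn n) F) (op_app B u)"
        using weak_lim_op_app[OF lin u(1)] sol[OF F Ff un] by simp
      moreover have "weak_lim (\<lambda>n. bn n (compr_inv V (bn n) F)) (b (op_app B u))"
        using u(2) sol[OF F Ff un] by (simp add: weakly_converges_iff weak_lim_def)
      moreover have "compr V b (op_app B u) = F"
        using u(3) satisfies_eq_iff_emb_adj[OF iso V F Ff] by (simp add: compr_def)
      ultimately show "\<exists>p\<in>V. weak_lim (\<lambda>n. compr_inv V (bn n) F) p \<and>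
          weak_lim (\<lambda>n. bn n (compr_inv V (bn n) F)) (b p) \<and> compr V b p = F"
        by blast
    qed
  next
    assume R: ?R
    show ?L
    proof (intro ballI allI impI)
      fix f un assume f: "f \<in> dual_on (op_dom B \<inter> R) (graph_norm B)"
        and un: "variational_solutions B R bn f un"
      obtain F where F: "F \<in> V" "\<And>\<phi>. \<phi> \<in> op_dom B \<inter> R \<Longrightarrow> f \<phi> = cinner F (op_app B \<phi>)"
        using reduced_dual_representation[OF iso V f] by blast
      obtain p where p: "p \<in> V" "weak_lim (\<lambda>n. compr_inv V (bn n) F) p"
        "weak_lim (\<lambda>n. bn n (compr_inv V (bn n) F)) (b p)" "compr V b p = F"
        using R F(1) by blast
      obtain u where u: "u \<in> op_dom B \<inter> R" "p = op_app B u"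
        using p(1) img by blast
      have sol_un: "op_app B (un n) = compr_inv V (bn n) F" for n
        by (rule sol[OF F un])
      have "un n \<in> op_dom B \<inter> R" for n
        using un by (simp add: variational_solutions_def)
      moreover have "weak_lim (\<lambda>n. op_app B (un n)) (op_app B u)"
        using p(2) u(2) by (simp add: sol_un)
      ultimately have "weakly_converges_on (op_dom B) (graph_norm B) un u"
        by (intro weakly_converges_graph_norm[OF iso V] u(1))
      moreover have "weakly_converges_on UNIV norm (\<lambda>n. bn n (op_app B (un n))) (b (op_app B u))"
        using p(3) u(2) by (simp add: weakly_converges_iff weak_lim_def sol_un)
      moreover have "satisfies_eq b (op_restrict B R) f u"
        using p(4) u(2) satisfies_eq_iff_emb_adj[OF iso V F] by (simp add: compr_def)
      ultimately show "variational_convergence B R bn b f un"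
        unfolding variational_convergence_def by blast
    qed
  qed
qed

section \<open>Coercivity in the weak limit\<close>

text \<open>
  The class \<open>\<M>(\<alpha>, \<beta>, (A\<^sub>0, A\<^sub>1))\<close> imposes this condition on \<open>a\<close> over \<open>ran A\<^sub>0\<close> with the bounds \<open>\<alpha>\<close>, \<open>1 / \<beta>\<close>, and on
  \<open>a\<^sup>-\<^sup>1\<close> over \<open>ran A\<^sub>1\<^sup>*\<close> with the bounds interchanged.
\<close>

definition coercive_pair :: "'a::complex_inner set \<Rightarrow> real \<Rightarrow> real \<Rightarrow> ('a \<Rightarrow> 'a) \<Rightarrow> bool"
  where "coercive_pair V c d b \<longleftrightarrow>
    (\<forall>x\<in>V. c * (norm x)\<^sup>2 \<le> inner (b x) x) \<and> (\<forall>y\<in>V. d * (norm y)\<^sup>2 \<le> inner (compr_inv V b y) y)"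

context
  fixes V :: "'a::chilbert_space set"
  assumes V: "csubspace V" "closed V"
begin

lemmas subspace_V = csubspace_imp_subspace[OF V(1)]

lemma compr_bij_betw:
  assumes b: "bounded_linear b" and "c > 0" and coercive: "\<And>x. x \<in> V \<Longrightarrow> c * (norm x)\<^sup>2 \<le> inner (b x) x"
  shows "bij_betw (compr V b) V V"
proof -
  obtain M where M: "\<And>x. norm (b x) \<le> norm x * M"
    using bounded_linear.bounded[OF b] by blast
  show ?thesis
  proof (rule lax_milgram[OF subspace_V V(2)])
    show "norm (compr V b x) \<le> M * norm x" for x
      using order_trans[OF norm_emb_adj_le[OF V] M, of x] by (simp add: compr_def mult.commute)
    show "c * (norm x)\<^sup>2 \<le> inner (compr V b x) x" if "x \<in> V" for x
      using coercive[OF that] inner_emb_adj[OF V that] by (simp add: compr_def)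
    show "compr V b (x - y) = compr V b x - compr V b y" for x y
      by (simp add: compr_def linear_diff[OF bounded_linear.linear[OF b]] emb_adj_diff[OF V])
  qed (use assms in \<open>auto simp: compr_def emb_adj_in[OF V]\<close>)
qed

lemma inner_compr: "x \<in> V \<Longrightarrow> inner (compr V b x) x = inner (b x) x"
  by (simp add: compr_def inner_emb_adj[OF V])

lemma compr_diff:
  assumes "bounded_linear b"
  shows "compr V b (x - y) = compr V b x - compr V b y"
  using assms by (simp add: compr_def linear_simps emb_adj_diff[OF V])

lemma compr_inv_diff:
  assumes b: "bounded_linear b" "bij_betw (compr V b) V V" and "x \<in> V" "y \<in> V"
  shows "compr_inv V b (x - y) = compr_inv V b x - compr_inv V b y"
  using compr_inv[OF b(2) assms(3)] compr_inv[OF b(2) assms(4)] subspace_V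
  by (intro compr_inv_eq[OF b(2)]) (auto simp: subspace_diff compr_diff[OF b(1)])

text \<open>
  If the inverse compressions converge weakly to some right inverse \<open>L\<close> of the compression of \<open>b\<close>, then \<open>L\<close>
  inherits both lower bounds: the bound \<open>d\<close> because \<open>\<langle>y, (b\<^sub>n)\<^sub>V\<^sup>-\<^sup>1 y\<rangle>\<close> converges, the bound \<open>c\<close> by weak lower
  semicontinuity of the norm.  The second one makes \<open>L\<close> bounded, the first one makes it coercive,
  hence onto, and a right inverse that is onto is the inverse.
\<close>

lemma coercive_pair_limit:
  assumes bn: "\<And>n. bounded_linear (bn n)" "\<And>n. coercive_pair V c d (bn n)" and cd: "c > 0" "d > 0"
    and b: "bounded_linear b"
    and lim: "\<And>F. F \<in> V \<Longrightarrow> \<exists>p\<in>V. weak_lim (\<lambda>n. compr_inv V (bn n) F) p \<and> compr V b p = F"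
  shows "coercive_pair V c d b" "bij_betw (compr V b) V V"
    "\<And>F. F \<in> V \<Longrightarrow> weak_lim (\<lambda>n. compr_inv V (bn n) F) (compr_inv V b F)"
proof -
  have bij: "bij_betw (compr V (bn n)) V V" for n
    using bn cd(1) by (intro compr_bij_betw) (auto simp: coercive_pair_def)
  obtain L where L: "\<And>F. F \<in> V \<Longrightarrow> L F \<in> V" "\<And>F. F \<in> V \<Longrightarrow> weak_lim (\<lambda>n. compr_inv V (bn n) F) (L F)"
    "\<And>F. F \<in> V \<Longrightarrow> compr V b (L F) = F"
    using bchoice[of V "\<lambda>F p. p \<in> V \<and> weak_lim (\<lambda>n. compr_inv V (bn n) F) p \<and> compr V b p = F"] lim
    by blast
  have L_diff: "L (x - y) = L x - L y" if "x \<in> V" "y \<in> V" for x y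
  proof (rule weak_lim_unique)
    show "weak_lim (\<lambda>n. compr_inv V (bn n) (x - y)) (L (x - y))"
      using that subspace_V by (intro L(2)) (auto simp: subspace_diff)
    show "weak_lim (\<lambda>n. compr_inv V (bn n) (x - y)) (L x - L y)"
      unfolding compr_inv_diff[OF bn(1) bij that] by (intro weak_lim_diff L(2) that)
  qed
  have L_d: "d * (norm F)\<^sup>2 \<le> inner (L F) F" if F: "F \<in> V" for F
  proof (rule LIMSEQ_le_const)
    have "(\<lambda>n. inner F (compr_inv V (bn n) F)) \<longlonglongrightarrow> inner F (L F)"
      using L(2)[OF F] by (simp add: weak_lim_def)
    then show "(\<lambda>n. inner (compr_inv V (bn n) F) F) \<longlonglongrightarrow> inner (L F) F"
      by (simp only: inner_commute[of F])
    show "\<exists>N. \<forall>n\<ge>N. d * (norm F)\<^sup>2 \<le> inner (compr_inv V (bn n) F) F"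
      using bn(2) F by (auto simp: coercive_pair_def)
  qed
  have L_c: "c * (norm (L F))\<^sup>2 \<le> inner F (L F)" if F: "F \<in> V" for F
  proof (rule LIMSEQ_le)
    let ?p = "\<lambda>n. compr_inv V (bn n) F"
    show "(\<lambda>n. inner F (?p n)) \<longlonglongrightarrow> inner F (L F)"
      using L(2)[OF F] by (simp add: weak_lim_def)
    have "(\<lambda>n. c * (2 * inner (L F) (?p n) - inner (L F) (L F))) \<longlonglongrightarrow>
        c * (2 * inner (L F) (L F) - inner (L F) (L F))"
      by (intro tendsto_mult tendsto_diff tendsto_const L(2)[OF F, unfolded weak_lim_def, rule_format])
    then show "(\<lambda>n. c * (2 * inner (L F) (?p n) - inner (L F) (L F))) \<longlonglongrightarrow> c * (norm (L F))\<^sup>2"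
      by (simp add: power2_norm_eq_inner)
    \<comment> \<open>\<open>|p\<^sub>n|\<^sup>2\<close> need not converge, but its tangent at the limit is a weakly continuous lower bound.\<close>
    have "c * (2 * inner (L F) (?p n) - inner (L F) (L F)) \<le> inner F (?p n)" for n
    proof -
      have "0 \<le> inner (?p n - L F) (?p n - L F)"
        by simp
      then have "2 * inner (L F) (?p n) - inner (L F) (L F) \<le> (norm (?p n))\<^sup>2"
        by (simp add: inner_diff_left inner_diff_right inner_commute power2_norm_eq_inner)
      then have "c * (2 * inner (L F) (?p n) - inner (L F) (L F)) \<le> c * (norm (?p n))\<^sup>2"
        using cd(1) by simp
      also have "\<dots> \<le> inner (bn n (?p n)) (?p n)"
        using bn(2) compr_inv(1)[OF bij F] by (simp add: coercive_pair_def)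
      also have "\<dots> = inner F (?p n)"
        using inner_compr[OF compr_inv(1)[OF bij F], of "bn n" n] compr_inv(2)[OF bij F, of n] by simp
      finally show ?thesis .
    qed
    then show "\<exists>N. \<forall>n\<ge>N. c * (2 * inner (L F) (?p n) - inner (L F) (L F)) \<le> inner F (?p n)"
      by blast
  qed
  have L_bound: "norm (L F) \<le> (1 / c) * norm F" if F: "F \<in> V" for F
  proof (cases "L F = 0")
    case True
    then show ?thesis using cd(1) by simp
  next
    case False
    have "norm (L F) * (c * norm (L F)) = c * (norm (L F))\<^sup>2"
      by (simp add: power2_eq_square)
    also have "\<dots> \<le> norm (L F) * norm F"
      using L_c[OF F] norm_cauchy_schwarz[of F "L F"] by (simp add: mult.commute)
    finally have "c * norm (L F) \<le> norm F"
      using False by (auto dest: mult_left_le_imp_le)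
    then show ?thesis
      using cd(1) by (simp add: field_simps)
  qed
  have L_bij: "bij_betw L V V"
    by (rule lax_milgram[OF subspace_V V(2) L(1) L_diff L_bound L_d cd(2)])
  have L_compr: "L (compr V b x) = x" if "x \<in> V" for x
  proof -
    obtain F where "F \<in> V" "x = L F"
      using L_bij \<open>x \<in> V\<close> unfolding bij_betw_def by blast
    then show ?thesis
      by (simp add: L(3))
  qed
  show bij_b: "bij_betw (compr V b) V V"
    by (rule bij_betw_byWitness[where f'=L])
      (use L L_compr in \<open>auto simp: compr_def emb_adj_in[OF V]\<close>)
  have inv_eq: "compr_inv V b F = L F" if "F \<in> V" for F
    by (rule compr_inv_eq[OF bij_b L(1)[OF that] L(3)[OF that]])
  show "coercive_pair V c d b"
    unfolding coercive_pair_def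
  proof (intro conjI ballI)
    fix x assume x: "x \<in> V"
    have "compr V b x \<in> V"
      by (simp add: compr_def emb_adj_in[OF V])
    from L_c[OF this] show "c * (norm x)\<^sup>2 \<le> inner (b x) x"
      using inner_compr[OF x, of b] L_compr[OF x] by simp
  qed (simp add: inv_eq L_d)
  show "weak_lim (\<lambda>n. compr_inv V (bn n) F) (compr_inv V b F)" if "F \<in> V" for F
    using L(2)[OF that] inv_eq[OF that] by simp
qed

end

section \<open>The Schur complement\<close>

text \<open>
  On \<open>V\<^sub>1\<close> this is \<open>b\<^sub>1\<^sub>1 - b\<^sub>1\<^sub>0 b\<^sub>0\<^sub>0\<^sup>-\<^sup>1 b\<^sub>0\<^sub>1\<close>.
\<close>

definition schur :: "'a::complex_inner set \<Rightarrow> 'a set \<Rightarrow> ('a \<Rightarrow> 'a) \<Rightarrow> 'a \<Rightarrow> 'a"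
  where "schur V0 V1 b x = emb_adj V1 (b x) - emb_adj V1 (b (compr_inv V0 b (emb_adj V0 (b x))))"

context
  fixes V0 V1 :: "'a::chilbert_space set"
  assumes V0: "csubspace V0" "closed V0" and V1: "csubspace V1" "closed V1"
    and V1_eq: "V1 = {x. \<forall>y\<in>V0. inner x y = 0}"
begin

lemma emb_adj_decomposition: "emb_adj V0 x + emb_adj V1 x = x"
proof -
  have "emb_adj V1 x = x - emb_adj V0 x"
  proof (rule emb_adj_unique[OF V1])
    show "x - emb_adj V0 x \<in> V1"
      unfolding V1_eq by (auto simp: inner_diff_left inner_emb_adj[OF V0])
    show "inner (x - emb_adj V0 x) z = inner x z" if "z \<in> V1" for z
      using that emb_adj_in[OF V0, of x] unfolding V1_eq
      by (simp add: inner_diff_left inner_commute[of "emb_adj V0 x" z])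
  qed
  then show ?thesis by simp
qed

lemma emb_adj_V0_of_V1: "x \<in> V1 \<Longrightarrow> emb_adj V0 x = 0"
  by (intro emb_adj_eq_0[OF V0]) (auto simp: V1_eq)

context
  fixes b :: "'a \<Rightarrow> 'a"
  assumes b: "bounded_linear b" "bij b" and bij0: "bij_betw (compr V0 b) V0 V0"
begin

lemma apply_compr_inv:
  assumes "F \<in> V0"
  shows "b (compr_inv V0 b F) = F + emb_adj V1 (b (compr_inv V0 b F))"
  using emb_adj_decomposition[of "b (compr_inv V0 b F)"] compr_inv(2)[OF bij0 assms]
  by (simp add: compr_def)

text \<open>
  Block elimination: for \<open>G \<in> V\<^sub>1\<close> and \<open>r \<in> V\<^sub>0\<close> the first component of \<open>b (G + r)\<close> vanishes precisely for
  \<open>r = - b\<^sub>0\<^sub>0\<^sup>-\<^sup>1 b\<^sub>0\<^sub>1 G\<close>, and then the second component is the Schur complement applied to \<open>G\<close>.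
\<close>

lemma inv_schur:
  "inv b (schur V0 V1 b G) = G - compr_inv V0 b (emb_adj V0 (b G))"
proof -
  define r where "r = compr_inv V0 b (emb_adj V0 (b G))"
  have "compr V0 b r = emb_adj V0 (b G)"
    unfolding r_def by (rule compr_inv(2)[OF bij0 emb_adj_in[OF V0]])
  then have "emb_adj V0 (b (G - r)) = 0"
    by (simp add: compr_def linear_simps(2)[OF b(1)] emb_adj_diff[OF V0])
  then have "b (G - r) = emb_adj V1 (b (G - r))"
    using emb_adj_decomposition[of "b (G - r)"] by simp
  also have "\<dots> = schur V0 V1 b G"
    by (simp add: schur_def r_def linear_simps(2)[OF b(1)] emb_adj_diff[OF V1])
  finally show ?thesis
    using b(2) unfolding r_def by (metis bij_inv_eq_iff)
qed

text \<open>
  The same elimination started from the other end: every \<open>q \<in> V\<^sub>1\<close> whose preimage under \<open>b\<close> has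
  second component \<open>G\<close> arises in this way, so the Schur complement is \<open>((b\<^sup>-\<^sup>1)\<^sub>1\<^sub>1)\<^sup>-\<^sup>1\<close>.
\<close>

lemma schur_unique:
  assumes "q \<in> V1" "compr V1 (inv b) q = G"
  shows "q = schur V0 V1 b G"
proof -
  define r where "r = emb_adj V0 (inv b q)"
  have q: "inv b q = r + G"
    using emb_adj_decomposition[of "inv b q"] assms(2) by (simp add: r_def compr_def)
  then have "q = b (r + G)"
    using b(2) by (metis bij_inv_eq_iff)
  then have "compr V0 b r + emb_adj V0 (b G) = 0"
    using emb_adj_V0_of_V1[OF assms(1)]
    by (simp add: compr_def linear_simps(1)[OF b(1)] emb_adj_add[OF V0])
  then have "compr V0 b (- r) = emb_adj V0 (b G)"
    by (simp add: compr_def linear_neg[OF bounded_linear.linear[OF b(1)]]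
        emb_adj_scaleR[OF V0, of "-1", simplified] add_eq_0_iff)
  moreover have "- r \<in> V0"
    using emb_adj_in[OF V0] csubspace_imp_subspace[OF V0(1)] by (simp add: r_def subspace_neg)
  ultimately have "compr_inv V0 b (emb_adj V0 (b G)) = - r"
    by (intro compr_inv_eq[OF bij0])
  then have "inv b (schur V0 V1 b G) = inv b q"
    using inv_schur[of G] q by simp
  then show ?thesis
    using b(2) by (metis bij_inv_eq_iff)
qed

lemma compr_inv_inv:
  assumes "bij_betw (compr V1 (inv b)) V1 V1" "G \<in> V1"
  shows "compr_inv V1 (inv b) G = schur V0 V1 b G"
  using compr_inv[OF assms] by (intro schur_unique)

end

end

section \<open>The block conditions\<close>

lemma block_eq:
  assumes "x \<in> comp_space A0 A1 k"
  shows "block A0 A1 j k a x = emb_adj (comp_space A0 A1 j) (a x)"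
  using assms by (simp add: block_def)

lemma block_inv_eq: "block_inv A0 A1 j a = compr_inv (comp_space A0 A1 j) a"
  unfolding block_inv_def compr_inv_def inv_into_def block_def compr_def fun_eq_iff
  by (intro allI arg_cong[where f=Eps]) auto

lemma op_class_iff:
  fixes A0 :: "('h0::chilbert_space, 'h1::chilbert_space) pop"
    and A1 :: "('h1, 'h2::chilbert_space) pop"
  assumes V0: "csubspace (comp_space A0 A1 0)" "closed (comp_space A0 A1 0)"
    and V1: "csubspace (comp_space A0 A1 1)" "closed (comp_space A0 A1 1)"
  shows "a \<in> op_class \<alpha> \<beta> A0 A1 \<longleftrightarrow> cont_invertible a \<and>
    coercive_pair (comp_space A0 A1 0) \<alpha> (1 / \<beta>) a \<and>
    coercive_pair (comp_space A0 A1 1) (1 / \<beta>) \<alpha> (inv a)"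
proof -
  have Re_ge: "Re_ge_on S T c \<longleftrightarrow> (\<forall>x\<in>S. c * (norm x)\<^sup>2 \<le> inner (T x) x)" for S :: "'h1 set" and T c
    by (simp add: Re_ge_on_def inner_eq_Re_cinner)
  have block_Re_ge: "Re_ge_on (comp_space A0 A1 j) (block A0 A1 j j b) c \<longleftrightarrow>
      (\<forall>x\<in>comp_space A0 A1 j. c * (norm x)\<^sup>2 \<le> inner (b x) x)"
    if "csubspace (comp_space A0 A1 j)" "closed (comp_space A0 A1 j)" for j b c
    unfolding Re_ge by (simp add: block_eq inner_emb_adj[OF that])
  show ?thesis
    unfolding op_class_def coercive_pair_def block_inv_eq block_Re_ge[OF V0] block_Re_ge[OF V1]
      Re_ge[of _ "compr_inv _ _"] by blast
qed

lemma nonlocally_H_converges_iff_compr: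
  fixes A0 :: "('h0::chilbert_space, 'h1::chilbert_space) pop"
    and A1 :: "('h1, 'h2::chilbert_space) pop"
  assumes A0: "densely_defined_closed A0" and A1: "densely_defined_closed A1"
    and ran: "closed (op_ran A0)" "closed (op_ran A1)"
    and bij0: "\<And>n. bij_betw (compr (op_ran A0) (an n)) (op_ran A0) (op_ran A0)"
    and bij1: "\<And>n. bij_betw (compr (op_ran (op_adj A1)) (inv (an n)))
      (op_ran (op_adj A1)) (op_ran (op_adj A1))"
  shows "nonlocally_H_converges A0 A1 an a \<longleftrightarrow>
    (\<forall>F\<in>op_ran A0. \<exists>p\<in>op_ran A0. weak_lim (\<lambda>n. compr_inv (op_ran A0) (an n) F) p \<and>
      weak_lim (\<lambda>n. an n (compr_inv (op_ran A0) (an n) F)) (a p) \<and> compr (op_ran A0) a p = F) \<and>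
    (\<forall>G\<in>op_ran (op_adj A1). \<exists>q\<in>op_ran (op_adj A1).
      weak_lim (\<lambda>n. compr_inv (op_ran (op_adj A1)) (inv (an n)) G) q \<and>
      weak_lim (\<lambda>n. inv (an n) (compr_inv (op_ran (op_adj A1)) (inv (an n)) G)) (inv a q) \<and>
      compr (op_ran (op_adj A1)) (inv a) q = G)"
proof -
  note iso0 = reduced_iso_operator[OF A0 ran(1)]
  note iso1 = reduced_iso_adjoint[OF A1 ran(2)]
  have V0: "csubspace (op_ran A0)" "closed (op_ran A0)"
    using csubspace_op_ran[OF csubspace_op_dom[OF A0] clinear_on_op_app[OF A0]] ran(1) .
  have V1: "csubspace (op_ran (op_adj A1))" "closed (op_ran (op_adj A1))"
    using csubspace_op_ran[OF csubspace_op_dom_adj[OF A1] clinear_on_op_adj[OF A1]]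
      closed_op_ran_adj[OF A1 ran(2)] .
  let ?D0 = "dual_on (op_dom A0 \<inter> op_ran (op_adj A0)) (graph_norm A0)"
  let ?D1 = "dual_on (op_dom (op_adj A1) \<inter> op_ran A1) (graph_norm (op_adj A1))"
  let ?s0 = "variational_solutions A0 (op_ran (op_adj A0)) an"
  let ?s1 = "variational_solutions (op_adj A1) (op_ran A1) (\<lambda>n. inv (an n))"
  let ?c0 = "variational_convergence A0 (op_ran (op_adj A0)) an a"
  let ?c1 = "variational_convergence (op_adj A1) (op_ran A1) (\<lambda>n. inv (an n)) (inv a)"
  \<comment> \<open>The two problems are coupled in the definition only by a conjunction, so each
    is decoupled by solving the other one with zero data.\<close>
  have z0: "(\<lambda>_. 0) \<in> ?D0"
    using cinner_op_app_dual[OF clinear_on_op_app[OF A0], of "op_dom A0 \<inter> op_ran (op_adj A0)" 0] by simp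
  have z1: "(\<lambda>_. 0) \<in> ?D1"
    using cinner_op_app_dual[OF clinear_on_op_adj[OF A1], of "op_dom (op_adj A1) \<inter> op_ran A1" 0] by simp
  obtain u0 where u0: "?s0 (\<lambda>_. 0) u0"
    using variational_solutions_exist[where bn=an, OF iso0 V0 bij0 z0] by blast
  obtain v0 where v0: "?s1 (\<lambda>_. 0) v0"
    using variational_solutions_exist[where bn="\<lambda>n. inv (an n)", OF iso1 V1 bij1 z1] by blast
  have "nonlocally_H_converges A0 A1 an a \<longleftrightarrow>
      (\<forall>f\<in>?D0. \<forall>un. ?s0 f un \<longrightarrow> ?c0 f un) \<and> (\<forall>g\<in>?D1. \<forall>vn. ?s1 g vn \<longrightarrow> ?c1 g vn)"
    unfolding nonlocally_H_converges_unfold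
    using z0 z1 u0 v0 by meson
  then show ?thesis
    unfolding variational_convergence_iff[where bn=an, OF iso0 V0 bij0]
      variational_convergence_iff[where bn="\<lambda>n. inv (an n)", OF iso1 V1 bij1] .
qed

section \<open>Characterisation of nonlocal H-convergence\<close>

theorem theorem4p1:
  fixes A0 :: "('h0::chilbert_space, 'h1::chilbert_space) pop"
    and A1 :: "('h1, 'h2::chilbert_space) pop"
    and \<alpha> \<beta> :: real
    and a :: "'h1 \<Rightarrow> 'h1"
    and an :: "nat \<Rightarrow> 'h1 \<Rightarrow> 'h1"
  assumes "densely_defined_closed A0" and "densely_defined_closed A1"
    and "closed_exact A0 A1"
    and "\<alpha> > 0" and "\<beta> > 0"
    and "bounded_clinear a"
    and "\<forall>n. an n \<in> op_class \<alpha> \<beta> A0 A1"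
  shows "cont_invertible a \<and> nonlocally_H_converges A0 A1 an a \<longleftrightarrow>
    a \<in> op_class \<alpha> \<beta> A0 A1 \<and>
    wot_converges (comp_space A0 A1 0) (comp_space A0 A1 0)
      (\<lambda>n. block_inv A0 A1 0 (an n))
      (block_inv A0 A1 0 a) \<and>
    wot_converges (comp_space A0 A1 0) (comp_space A0 A1 1)
      (\<lambda>n. block A0 A1 1 0 (an n) \<circ> block_inv A0 A1 0 (an n))
      (block A0 A1 1 0 a \<circ> block_inv A0 A1 0 a) \<and>
    wot_converges (comp_space A0 A1 1) (comp_space A0 A1 0)
      (\<lambda>n. block_inv A0 A1 0 (an n) \<circ> block A0 A1 0 1 (an n))
      (block_inv A0 A1 0 a \<circ> block A0 A1 0 1 a) \<and>
    wot_converges (comp_space A0 A1 1) (comp_space A0 A1 1)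
      (\<lambda>n x. block A0 A1 1 1 (an n) x -
        (block A0 A1 1 0 (an n) \<circ> block_inv A0 A1 0 (an n) \<circ> block A0 A1 0 1 (an n)) x)
      (\<lambda>x. block A0 A1 1 1 a x -
        (block A0 A1 1 0 a \<circ> block_inv A0 A1 0 a \<circ> block A0 A1 0 1 a) x)"
    (is "?lhs \<longleftrightarrow> a \<in> _ \<and> ?wot1 \<and> ?wot2 \<and> ?wot3 \<and> ?wot4")
proof -
  note A0 = assms(1) and A1 = assms(2)
  have ran: "closed (op_ran A0)" "closed (op_ran A1)" and exact: "op_ran A0 = op_ker A1"
    using assms(3) by (auto simp: closed_exact_def)
  define V0 where "V0 = op_ran A0"
  define V1 where "V1 = op_ran (op_adj A1)"
  have comp: "comp_space A0 A1 0 = V0" "comp_space A0 A1 1 = V1"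
    by (simp_all add: comp_space_def V0_def V1_def)
  have V0: "csubspace V0" "closed V0"
    using csubspace_op_ran[OF csubspace_op_dom[OF A0] clinear_on_op_app[OF A0]] ran(1)
    unfolding V0_def .
  have V1: "csubspace V1" "closed V1"
    using csubspace_op_ran[OF csubspace_op_dom_adj[OF A1] clinear_on_op_adj[OF A1]]
      closed_op_ran_adj[OF A1 ran(2)] unfolding V1_def .
  have V1_eq: "V1 = {x. \<forall>y\<in>V0. inner x y = 0}"
    unfolding V1_def V0_def exact by (rule op_ran_adj[OF A1 ran(2)])
  have \<beta>: "1 / \<beta> > 0"
    using assms(5) by simp
  have class_iff: "b \<in> op_class \<alpha> \<beta> A0 A1 \<longleftrightarrow> cont_invertible b \<and>
      coercive_pair V0 \<alpha> (1 / \<beta>) b \<and> coercive_pair V1 (1 / \<beta>) \<alpha> (inv b)" for b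
    using op_class_iff[of A0 A1 b \<alpha> \<beta>] V0 V1 unfolding comp by blast
  have ci: "bounded_linear b" "bounded_linear (inv b)" "bij b" if "cont_invertible b" for b :: "'h1 \<Rightarrow> 'h1"
    using that by (auto simp: cont_invertible_def bounded_clinear_def)
  have class_bij: "bij_betw (compr V0 b) V0 V0" "bij_betw (compr V1 (inv b)) V1 V1"
    if "b \<in> op_class \<alpha> \<beta> A0 A1" for b
    using that compr_bij_betw[OF V0 _ assms(4), of b] compr_bij_betw[OF V1 _ \<beta>, of "inv b"] ci[of b]
    unfolding class_iff coercive_pair_def by blast+
  have an: "an n \<in> op_class \<alpha> \<beta> A0 A1" for n
    using assms(7) by blast
  have an_ci: "cont_invertible (an n)" and an_c: "coercive_pair V0 \<alpha> (1 / \<beta>) (an n)"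
      "coercive_pair V1 (1 / \<beta>) \<alpha> (inv (an n))" for n
    using an unfolding class_iff by blast+
  note bij0 = class_bij(1)[OF an] and bij1 = class_bij(2)[OF an]
  note schur_inv = inv_schur[OF V0 V1 V1_eq] and schur_eq = compr_inv_inv[OF V0 V1 V1_eq]
    and decomp = apply_compr_inv[OF V0 V1 V1_eq]
  have H_iff: "nonlocally_H_converges A0 A1 an a \<longleftrightarrow>
    (\<forall>F\<in>V0. \<exists>p\<in>V0. weak_lim (\<lambda>n. compr_inv V0 (an n) F) p \<and>
      weak_lim (\<lambda>n. an n (compr_inv V0 (an n) F)) (a p) \<and> compr V0 a p = F) \<and>
    (\<forall>G\<in>V1. \<exists>q\<in>V1. weak_lim (\<lambda>n. compr_inv V1 (inv (an n)) G) q \<and>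
      weak_lim (\<lambda>n. inv (an n) (compr_inv V1 (inv (an n)) G)) (inv a q) \<and> compr V1 (inv a) q = G)"
    unfolding V0_def V1_def
    by (rule nonlocally_H_converges_iff_compr[OF A0 A1 ran])
      (use bij0 bij1 in \<open>simp_all add: V0_def V1_def\<close>)
  have wot_iff:
    "?wot1 \<longleftrightarrow> (\<forall>F\<in>V0. weak_lim (\<lambda>n. compr_inv V0 (an n) F) (compr_inv V0 a F))"
    "?wot2 \<longleftrightarrow> (\<forall>F\<in>V0. weak_lim (\<lambda>n. emb_adj V1 (an n (compr_inv V0 (an n) F)))
      (emb_adj V1 (a (compr_inv V0 a F))))"
    "?wot3 \<longleftrightarrow> (\<forall>G\<in>V1. weak_lim (\<lambda>n. compr_inv V0 (an n) (emb_adj V0 (an n G)))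
      (compr_inv V0 a (emb_adj V0 (a G))))"
    "?wot4 \<longleftrightarrow> (\<forall>G\<in>V1. weak_lim (\<lambda>n. schur V0 V1 (an n) G) (schur V0 V1 a G))"
    if bij_a: "bij_betw (compr V0 a) V0 V0"
  proof -
    have in0: "compr_inv V0 b F \<in> V0" if "b = a \<or> b \<in> range an" "F \<in> V0" for b F
      using that compr_inv(1)[OF bij_a] compr_inv(1)[OF bij0] by auto
    note simps = wot_converges_def comp comp(2)[unfolded One_nat_def] block_inv_eq block_eq comp_def
      weakly_converges_on_iff_weak_lim[OF V0] weakly_converges_on_iff_weak_lim[OF V1]
      in0 emb_adj_in[OF V0] emb_adj_in[OF V1] schur_def
      subspace_diff[OF csubspace_imp_subspace[OF V1(1)]]
    show "?wot1 \<longleftrightarrow> (\<forall>F\<in>V0. weak_lim (\<lambda>n. compr_inv V0 (an n) F) (compr_inv V0 a F))"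
      by (simp add: simps)
    show "?wot2 \<longleftrightarrow> (\<forall>F\<in>V0. weak_lim (\<lambda>n. emb_adj V1 (an n (compr_inv V0 (an n) F)))
        (emb_adj V1 (a (compr_inv V0 a F))))"
      by (simp add: simps)
    show "?wot3 \<longleftrightarrow> (\<forall>G\<in>V1. weak_lim (\<lambda>n. compr_inv V0 (an n) (emb_adj V0 (an n G)))
        (compr_inv V0 a (emb_adj V0 (a G))))"
      by (simp add: simps)
    show "?wot4 \<longleftrightarrow> (\<forall>G\<in>V1. weak_lim (\<lambda>n. schur V0 V1 (an n) G) (schur V0 V1 a G))"
      by (simp add: simps)
  qed
  show ?thesis
  proof
    assume lhs: ?lhs
    then have a_ci: "cont_invertible a" by blast
    have H0: "\<exists>p\<in>V0. weak_lim (\<lambda>n. compr_inv V0 (an n) F) p \<and>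
        weak_lim (\<lambda>n. an n (compr_inv V0 (an n) F)) (a p) \<and> compr V0 a p = F" if "F \<in> V0" for F
      using lhs that unfolding H_iff by blast
    have H1: "\<exists>q\<in>V1. weak_lim (\<lambda>n. compr_inv V1 (inv (an n)) G) q \<and>
        weak_lim (\<lambda>n. inv (an n) (compr_inv V1 (inv (an n)) G)) (inv a q) \<and> compr V1 (inv a) q = G"
      if "G \<in> V1" for G
      using lhs that unfolding H_iff by blast
    have lim0: "coercive_pair V0 \<alpha> (1 / \<beta>) a" "bij_betw (compr V0 a) V0 V0"
      "\<And>F. F \<in> V0 \<Longrightarrow> weak_lim (\<lambda>n. compr_inv V0 (an n) F) (compr_inv V0 a F)"
      using coercive_pair_limit[where bn=an, OF V0 ci(1)[OF an_ci] an_c(1) assms(4) \<beta> ci(1)[OF a_ci]] H0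
      by blast+
    have lim1: "coercive_pair V1 (1 / \<beta>) \<alpha> (inv a)" "bij_betw (compr V1 (inv a)) V1 V1"
      "\<And>G. G \<in> V1 \<Longrightarrow> weak_lim (\<lambda>n. compr_inv V1 (inv (an n)) G) (compr_inv V1 (inv a) G)"
      using coercive_pair_limit[where bn="\<lambda>n. inv (an n)", OF V1 ci(2)[OF an_ci] an_c(2) \<beta> assms(4) ci(2)[OF a_ci]] H1
      by blast+
    note a = ci(1)[OF a_ci] ci(3)[OF a_ci] lim0(2)
    have "weak_lim (\<lambda>n. emb_adj V1 (an n (compr_inv V0 (an n) F))) (emb_adj V1 (a (compr_inv V0 a F)))"
      if F: "F \<in> V0" for F
    proof (rule weak_lim_emb_adj[OF V1])
      obtain p where p: "p \<in> V0" "weak_lim (\<lambda>n. an n (compr_inv V0 (an n) F)) (a p)" "compr V0 a p = F"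
        using H0[OF F] by blast
      then show "weak_lim (\<lambda>n. an n (compr_inv V0 (an n) F)) (a (compr_inv V0 a F))"
        using compr_inv_eq[OF lim0(2) p(1,3)] by simp
    qed
    moreover have "weak_lim (\<lambda>n. compr_inv V0 (an n) (emb_adj V0 (an n G))) (compr_inv V0 a (emb_adj V0 (a G)))"
      if G: "G \<in> V1" for G
    proof -
      obtain q where q: "q \<in> V1" "compr V1 (inv a) q = G"
        "weak_lim (\<lambda>n. inv (an n) (compr_inv V1 (inv (an n)) G)) (inv a q)"
        using H1[OF G] by blast
      have "q = schur V0 V1 a G"
        by (rule schur_unique[OF V0 V1 V1_eq a q(1,2)])
      then have "weak_lim (\<lambda>n. G - compr_inv V0 (an n) (emb_adj V0 (an n G)))
          (G - compr_inv V0 a (emb_adj V0 (a G)))"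
        using q(3) schur_eq[OF ci(1,3)[OF an_ci] bij0 bij1 G] schur_inv[OF ci(1,3)[OF an_ci] bij0, of _ G]
          schur_inv[OF a, of G]
        by simp
      from weak_lim_diff[OF weak_lim_const[of G] this] show ?thesis
        by simp
    qed
    moreover have "weak_lim (\<lambda>n. schur V0 V1 (an n) G) (schur V0 V1 a G)" if G: "G \<in> V1" for G
      using lim1(3)[OF G] schur_eq[OF ci(1,3)[OF an_ci] bij0 bij1 G] schur_eq[OF a lim1(2) G]
      by simp
    ultimately show "a \<in> op_class \<alpha> \<beta> A0 A1 \<and> ?wot1 \<and> ?wot2 \<and> ?wot3 \<and> ?wot4"
      unfolding wot_iff[OF lim0(2)] class_iff using a_ci lim0(1,3) lim1(1) by blast
  next
    assume rhs: "a \<in> op_class \<alpha> \<beta> A0 A1 \<and> ?wot1 \<and> ?wot2 \<and> ?wot3 \<and> ?wot4"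
    then have a_class: "a \<in> op_class \<alpha> \<beta> A0 A1" by blast
    then have a_ci: "cont_invertible a" by (simp add: class_iff)
    note a_bij = class_bij[OF a_class]
    note a = ci(1)[OF a_ci] ci(3)[OF a_ci] a_bij(1)
    have W1: "\<And>F. F \<in> V0 \<Longrightarrow> weak_lim (\<lambda>n. compr_inv V0 (an n) F) (compr_inv V0 a F)"
      and W2: "\<And>F. F \<in> V0 \<Longrightarrow> weak_lim (\<lambda>n. emb_adj V1 (an n (compr_inv V0 (an n) F)))
        (emb_adj V1 (a (compr_inv V0 a F)))"
      and W3: "\<And>G. G \<in> V1 \<Longrightarrow> weak_lim (\<lambda>n. compr_inv V0 (an n) (emb_adj V0 (an n G)))
        (compr_inv V0 a (emb_adj V0 (a G)))"
      and W4: "\<And>G. G \<in> V1 \<Longrightarrow> weak_lim (\<lambda>n. schur V0 V1 (an n) G) (schur V0 V1 a G)"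
      using rhs unfolding wot_iff[OF a_bij(1)] by blast+
    have "weak_lim (\<lambda>n. compr_inv V0 (an n) F) (compr_inv V0 a F) \<and>
        weak_lim (\<lambda>n. an n (compr_inv V0 (an n) F)) (a (compr_inv V0 a F)) \<and>
        compr V0 a (compr_inv V0 a F) = F" if F: "F \<in> V0" for F
    proof (intro conjI W1 F compr_inv(2)[OF a_bij(1)])
      show "weak_lim (\<lambda>n. an n (compr_inv V0 (an n) F)) (a (compr_inv V0 a F))"
        using weak_lim_add[OF weak_lim_const[of F] W2[OF F]]
        unfolding decomp[OF ci(1,3)[OF an_ci] bij0 F, symmetric] decomp[OF a F, symmetric] .
    qed
    moreover have "weak_lim (\<lambda>n. compr_inv V1 (inv (an n)) G) (compr_inv V1 (inv a) G) \<and>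
        weak_lim (\<lambda>n. inv (an n) (compr_inv V1 (inv (an n)) G)) (inv a (compr_inv V1 (inv a) G)) \<and>
        compr V1 (inv a) (compr_inv V1 (inv a) G) = G" if G: "G \<in> V1" for G
    proof (intro conjI compr_inv(2)[OF a_bij(2)] G)
      note eqs = schur_eq[OF ci(1,3)[OF an_ci] bij0 bij1 G] schur_eq[OF a a_bij(2) G]
      show "weak_lim (\<lambda>n. compr_inv V1 (inv (an n)) G) (compr_inv V1 (inv a) G)"
        unfolding eqs by (rule W4[OF G])
      show "weak_lim (\<lambda>n. inv (an n) (compr_inv V1 (inv (an n)) G)) (inv a (compr_inv V1 (inv a) G))"
        unfolding eqs schur_inv[OF ci(1,3)[OF an_ci] bij0] schur_inv[OF a]
        by (intro weak_lim_diff weak_lim_const W3 G)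
    qed
    ultimately show ?lhs
      unfolding H_iff using a_ci compr_inv(1)[OF a_bij(1)] compr_inv(1)[OF a_bij(2)] by blast
  qed
qed

end
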